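(* Let $\mathcal{W}\subset\mathbb{R}^2$ be an open, convex, Jordan measurable set containing the origin. Then $$m_{\widehat{\mathcal{A}_\mathcal{W}}}=\frac{\lambda^{-m}\,\theta(\widehat{\mathcal{A}_\mathcal{W}})}{2\sqrt2},$$ where $m$ is the maximal integer such that $\lambda^m<2\sqrt2\,T_\mathcal{W}$.
   Context: Identify $\mathbb{C}$ with $\mathbb{R}^2$. Jordan measurable means bounded with boundary of Lebesgue measure zero. For a locally finite set $\mathcal{P}\subset\mathbb{R}^d$, the set of visible points is $\widehat{\mathcal{P}}=\{x\in\mathcal{P}\mid tx\notin\mathcal{P}\ \forall t\in(0,1)\}$. $\mathcal{P}$ has density $\theta(\mathcal{P})$ if $\lim_{T\to\infty}\#(\mathcal{P}\cap TD)/\mathrm{vol}(TD)=\theta(\mathcal{P})$ for every Jordan measurable $D\subset\mathbb{R}^d$ with $\mathrm{vol}(D)>0$. Minimal gap. Let $\mathcal{P}\subset\mathbb{R}^2$ be locally finite. For $T>0$ let $\widehat{\mathcal{P}}_T=\{x\in\widehat{\mathcal{P}}:|x|<T\}$, $\widehat N(T)=\#\widehat{\mathcal{P}}_T$; let $\alpha(x)\in(-\pi,\pi]$ be the argument of $x$ and arrange the numbers $\alpha(x)/(2\pi)$, $x\in\widehat{\mathcal{P}}_T$, in increasing order as $-\frac12<\widehat\xi_{T,1}<\cdots<\widehat\xi_{T,\widehat N(T)}\le\frac12$, and set $\widehat\xi_{T,0}=\widehat\xi_{T,\widehat N(T)}-1$. Put $\widehat d_{T,i}=\widehat N(T)(\widehat\xi_{T,i}-\widehat\xi_{T,i-1})$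 and $F_T(s)=\#\{1\le i\le\widehat N(T)\mid\widehat d_{T,i}\ge s\}/\widehat N(T)$. If the empirical measures of the $\widehat d_{T,i}$ converge weakly as $T\to\infty$ to a Borel probability measure $\mu$ on $\mathbb{R}$, let $F(s)=\mu([s,\infty))$ and define $m_{\widehat{\mathcal{P}}}=\sup\{\sigma\ge0\mid F(s)=1\text{ for all }s\in[0,\sigma]\}$. (By a theorem of Marklof and Strömbergsson, the limit $F$ and the densities $\theta(\mathcal{P}),\theta(\widehat{\mathcal{P}})$ exist for all regular planar cut-and-project sets, in particular for the sets $\mathcal{A}_\mathcal{W}$ considered here.) $\mathcal{A}$-sets. Let $\zeta=e^{2\pi i/8}$, let $\sigma$ be the automorphism of $\mathbb{Q}(\zeta)$ with $\sigma(\zeta)=\zeta^3$, $\lambda=1+\sqrt2$, and for bounded $\mathcal{W}\subset\mathbb{C}$ let $\mathcal{A}_\mathcal{W}=\{x\in\mathbb{Z}[\zeta]\mid\sigma(x)\in\mathcal{W}\}$. For $x,y\in\mathbb{R}^2$ let $\Delta(x,y)$ be the area of the triangle with vertices $0,x,y$, and $T_\mathcal{W}=\sup_{x,y\in\mathcal{W}}\Delta(x,y)$. *)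

theory Defs
  imports "HOL-Probability.Probability"
begin

definition jordan_measurable :: "'a::euclidean_space set \<Rightarrow> bool" where
  "jordan_measurable D \<longleftrightarrow> bounded D \<and> frontier D \<in> null_sets lebesgue"

definition visible :: "'a::real_vector set \<Rightarrow> 'a set" where
  "visible P = {x \<in> P. \<forall>t::real. 0 < t \<and> t < 1 \<longrightarrow> t *\<^sub>R x \<notin> P}"

definition has_density :: "'a::euclidean_space set \<Rightarrow> real \<Rightarrow> bool" where
  "has_density P \<theta> \<longleftrightarrow>
     (\<forall>D. jordan_measurable D \<and> measure lebesgue D > 0 \<longrightarrow>
        ((\<lambda>T::real. real (card (P \<inter> (*\<^sub>R) T ` D)) / measure lebesgue ((*\<^sub>R) T ` D)) \<longlongrightarrow> \<theta>) at_top)"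

text \<open>Meaningful only if a density exists; it is then unique.\<close>

definition density_of :: "'a::euclidean_space set \<Rightarrow> real" where
  "density_of P = (THE \<theta>. has_density P \<theta>)"


section \<open>Gaps between the directions of visible points\<close>

text \<open>In this section \<open>P\<close> is meant to be locally finite, so that the finite-set operations below
  are meaningful. Distinct visible points have distinct arguments, so that
  \<open>length (directions P T) = num_visible P T\<close>.\<close>

definition visible_upto :: "complex set \<Rightarrow> real \<Rightarrow> complex set" where
  "visible_upto P T = {x \<in> visible P. norm x < T}"

definition num_visible :: "complex set \<Rightarrow> real \<Rightarrow> nat" where
  "num_visible P T = card (visible_upto P T)"

definition directions :: "complex set \<Rightarrow> real \<Rightarrow> real list" where
  "directions P T = sorted_list_of_set ((\<lambda>x. Arg x / (2 * pi)) ` visible_upto P T)"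

definition direction :: "complex set \<Rightarrow> real \<Rightarrow> nat \<Rightarrow> real" where
  "direction P T i =
     (if i = 0 then directions P T ! (num_visible P T - 1) - 1 else directions P T ! (i - 1))"

definition gap :: "complex set \<Rightarrow> real \<Rightarrow> nat \<Rightarrow> real" where
  "gap P T i = real (num_visible P T) * (direction P T i - direction P T (i - 1))"

definition gap_measure :: "complex set \<Rightarrow> real \<Rightarrow> real measure" where
  "gap_measure P T = distr (uniform_count_measure {1..num_visible P T}) borel (gap P T)"

text \<open>The library has weak convergence for sequences of measures only. Weak convergence as the
  real parameter \<open>T\<close> tends to infinity is convergence along all sequences tending to infinity.\<close>

definition has_gap_limit :: "complex set \<Rightarrow> real measure \<Rightarrow> bool" where
  "has_gap_limit P \<mu> \<longleftrightarrow> real_distribution \<mu> \<and>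
     (\<forall>T :: nat \<Rightarrow> real. filterlim T at_top sequentially \<longrightarrow>
        weak_conv_m (\<lambda>n. gap_measure P (T n)) \<mu>)"

text \<open>Meaningful only if a weak limit exists; it is then unique.\<close>

definition gap_limit :: "complex set \<Rightarrow> real measure" where
  "gap_limit P = (THE \<mu>. has_gap_limit P \<mu>)"

definition gap_tail :: "complex set \<Rightarrow> real \<Rightarrow> real" where
  "gap_tail P s = measure (gap_limit P) {s..}"

text \<open>The visible points of \<open>P\<close> are taken inside the definition; the argument is \<open>P\<close> itself.\<close>

definition min_gap :: "complex set \<Rightarrow> real" where
  "min_gap P = Sup {\<sigma>. 0 \<le> \<sigma> \<and> (\<forall>s \<in> {0..\<sigma>}. gap_tail P s = 1)}"


section \<open>The eighth cyclotomic field\<close>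

text \<open>The powers up to the third suffice for \<open>\<int>[\<zeta>]\<close> and \<open>\<rat>(\<zeta>)\<close>, as \<open>\<zeta>\<close> is a root of the monic
  irreducible polynomial \<open>X\<^sup>4 + 1\<close>. Lemma \<open>sigma8_ex1\<close> below justifies the description of
  \<open>\<sigma>\<close>; its values outside \<open>\<rat>(\<zeta>)\<close> are irrelevant.\<close>

definition zeta8 :: complex where
  "zeta8 = cis (2 * pi / 8)"

definition int_zeta8 :: "complex set" where
  "int_zeta8 = {(\<Sum>k<4. of_int (c k) * zeta8 ^ k) | c :: nat \<Rightarrow> int. True}"

definition rat_zeta8 :: "complex set" where
  "rat_zeta8 = {(\<Sum>k<4. of_rat (c k) * zeta8 ^ k) | c :: nat \<Rightarrow> rat. True}"

definition field_aut_on :: "complex set \<Rightarrow> (complex \<Rightarrow> complex) \<Rightarrow> bool" where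
  "field_aut_on K s \<longleftrightarrow> bij_betw s K K \<and>
     (\<forall>x\<in>K. \<forall>y\<in>K. s (x + y) = s x + s y \<and> s (x * y) = s x * s y)"

definition sigma8 :: "complex \<Rightarrow> complex" where
  "sigma8 = (THE s. s \<in> extensional rat_zeta8 \<and> field_aut_on rat_zeta8 s \<and> s zeta8 = zeta8 ^ 3)"

definition lam :: real where
  "lam = 1 + sqrt 2"

definition A_set :: "complex set \<Rightarrow> complex set" where
  "A_set W = {x \<in> int_zeta8. sigma8 x \<in> W}"

definition tri_area :: "complex \<Rightarrow> complex \<Rightarrow> real" where
  "tri_area x y = measure lebesgue (convex hull {0, x, y})"

definition max_tri_area :: "complex set \<Rightarrow> real" where
  "max_tri_area W = (SUP (x, y) \<in> W \<times> W. tri_area x y)"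


section \<open>Well-definedness\<close>

lemma density_of_eq:
  fixes P :: "'a::euclidean_space set"
  assumes "has_density P \<theta>"
  shows "density_of P = \<theta>"
  unfolding density_of_def
proof (rule the_equality, fact assms)
  fix \<theta>' assume \<theta>': "has_density P \<theta>'"
  have "jordan_measurable (cball (0::'a) 1)"
    by (simp add: jordan_measurable_def negligible_sphere flip: negligible_iff_null_sets)
  moreover have "measure lebesgue (cball (0::'a) 1) > 0"
    by (simp add: content_cball_pos)
  ultimately show "\<theta>' = \<theta>"
    using assms \<theta>' unfolding has_density_def
    by (blast intro: tendsto_unique[OF trivial_limit_at_top_linorder])
qed

lemma gap_limit_eq:
  assumes "has_gap_limit P \<mu>"
  shows "gap_limit P = \<mu>"
  unfolding gap_limit_def
proof (rule the_equality, fact assms)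
  fix \<nu> assume \<nu>: "has_gap_limit P \<nu>"
  interpret m: real_distribution \<mu> using assms by (simp add: has_gap_limit_def)
  interpret n: real_distribution \<nu> using \<nu> by (simp add: has_gap_limit_def)
  have T: "filterlim (\<lambda>n. real n) at_top sequentially" by (rule filterlim_real_sequentially)
  have \<mu>_lim: "isCont (cdf \<mu>) x \<Longrightarrow> (\<lambda>n. cdf (gap_measure P (real n)) x) \<longlonglongrightarrow> cdf \<mu> x" for x
    using assms T unfolding has_gap_limit_def weak_conv_m_def weak_conv_def by blast
  have \<nu>_lim: "isCont (cdf \<nu>) x \<Longrightarrow> (\<lambda>n. cdf (gap_measure P (real n)) x) \<longlonglongrightarrow> cdf \<nu> x" for x
    using \<nu> T unfolding has_gap_limit_def weak_conv_m_def weak_conv_def by blast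
  let ?C = "{x. \<not> isCont (cdf \<mu>) x} \<union> {x. \<not> isCont (cdf \<nu>) x}"
  have C: "countable ?C"
    using m.countable_atoms n.countable_atoms
    by (simp add: m.isCont_cdf n.isCont_cdf measure_nonneg less_le eq_commute[of 0])
  have eq: "cdf \<mu> x = cdf \<nu> x" if "x \<notin> ?C" for x
    using \<mu>_lim[of x] \<nu>_lim[of x] that by (auto intro: LIMSEQ_unique)
  have "cdf \<nu> = cdf \<mu>"
  proof
    fix x
    have lm: "(cdf \<mu> \<longlongrightarrow> cdf \<mu> x) (at_right x)" "(cdf \<nu> \<longlongrightarrow> cdf \<nu> x) (at_right x)"
      using m.cdf_is_right_cont n.cdf_is_right_cont by (auto simp: continuous_within)
    show "cdf \<nu> x = cdf \<mu> x"
    proof (rule ccontr)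
      assume "cdf \<nu> x \<noteq> cdf \<mu> x"
      moreover have "((\<lambda>y. cdf \<nu> y - cdf \<mu> y) \<longlongrightarrow> cdf \<nu> x - cdf \<mu> x) (at_right x)"
        using lm by (intro tendsto_intros)
      ultimately have "eventually (\<lambda>y. cdf \<nu> y - cdf \<mu> y \<noteq> 0) (at_right x)"
        by (intro tendsto_imp_eventually_ne[of _ "cdf \<nu> x - cdf \<mu> x"]) auto
      then obtain b where b: "x < b" "\<And>y. x < y \<Longrightarrow> y < b \<Longrightarrow> cdf \<nu> y - cdf \<mu> y \<noteq> 0"
        unfolding eventually_at_right_field by blast
      then have "{x<..<b} \<subseteq> ?C" using eq by force
      with C have "countable {x<..<b}" by (rule countable_subset[rotated])
      with \<open>x < b\<close> show False using uncountable_open_interval by blast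
    qed
  qed
  then show "\<nu> = \<mu>"
    by (rule cdf_unique[OF n.real_distribution_axioms m.real_distribution_axioms])
qed

definition zcomb :: "rat \<Rightarrow> rat \<Rightarrow> rat \<Rightarrow> rat \<Rightarrow> complex" where
  "zcomb a b c d = of_rat a + of_rat b * zeta8 + of_rat c * zeta8 ^ 2 + of_rat d * zeta8 ^ 3"

lemma zeta8_eq: "zeta8 = Complex (1 / sqrt 2) (1 / sqrt 2)"
  by (simp add: zeta8_def complex_eq_iff cos_45 sin_45 real_div_sqrt field_simps)

lemma zeta8_sq: "zeta8 ^ 2 = \<i>"
  by (simp add: zeta8_eq complex_eq_iff power2_eq_square)

lemma zeta8_pow4: "zeta8 ^ 4 = - 1"
  by (metis zeta8_sq i_squared mult_2 numeral_Bit0 power_add power2_eq_square)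

lemma rat_zeta8_iff: "x \<in> rat_zeta8 \<longleftrightarrow> (\<exists>a b c d. x = zcomb a b c d)"
proof
  assume "x \<in> rat_zeta8"
  then obtain c :: "nat \<Rightarrow> rat" where "x = (\<Sum>k<4. of_rat (c k) * zeta8 ^ k)"
    by (auto simp: rat_zeta8_def)
  then have "x = zcomb (c 0) (c 1) (c 2) (c 3)"
    by (simp add: zcomb_def eval_nat_numeral)
  then show "\<exists>a b c d. x = zcomb a b c d" by blast
next
  assume "\<exists>a b c d. x = zcomb a b c d"
  then obtain a b c d where x: "x = zcomb a b c d" by blast
  have "x = (\<Sum>k<4. of_rat ((\<lambda>k::nat. [a, b, c, d] ! k) k) * zeta8 ^ k)"
    by (simp add: x zcomb_def eval_nat_numeral)
  then show "x \<in> rat_zeta8" unfolding rat_zeta8_def by blast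
qed

lemma zcomb_in [simp]: "zcomb a b c d \<in> rat_zeta8"
  by (auto simp: rat_zeta8_iff)

lemma zcomb_Complex:
  "zcomb a b c d = Complex (of_rat a + (of_rat b - of_rat d) / sqrt 2)
                           (of_rat c + (of_rat b + of_rat d) / sqrt 2)"
proof -
  have r: "of_rat q = complex_of_real (of_rat q)" for q
    by (cases q) (simp add: of_rat_rat)
  have "zeta8 ^ 3 = zeta8 ^ 2 * zeta8" by (simp add: eval_nat_numeral)
  also have "\<dots> = Complex (- 1 / sqrt 2) (1 / sqrt 2)"
    unfolding zeta8_sq unfolding zeta8_eq by (simp add: complex_eq_iff)
  finally have z3: "zeta8 ^ 3 = Complex (- 1 / sqrt 2) (1 / sqrt 2)" .
  show ?thesis
    unfolding zcomb_def r z3 zeta8_sq unfolding zeta8_eq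
    by (simp add: complex_eq_iff field_simps)
qed

lemma rat_square_neq_2: "r\<^sup>2 \<noteq> (2::rat)"
proof
  assume r: "r\<^sup>2 = 2"
  obtain m n :: int where mn: "r = of_int m / of_int n" "n > 0" "coprime m n"
    by (metis Fract_of_int_quotient Rat_cases)
  have "(of_int m)\<^sup>2 = (2::rat) * (of_int n)\<^sup>2"
    using r mn by (simp add: power_divide field_simps)
  then have eq: "m\<^sup>2 = 2 * n\<^sup>2"
    by (metis of_int_eq_iff of_int_mult of_int_numeral of_int_power)
  then have "n\<^sup>2 dvd m\<^sup>2" by simp
  moreover have "coprime (n\<^sup>2) (m\<^sup>2)"
    using mn(3) by (simp add: coprime_commute)
  ultimately have "is_unit (n\<^sup>2)"
    by (metis coprime_absorb_left)
  then have "n\<^sup>2 = 1" by simp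
  with eq have m2: "m\<^sup>2 = 2" by simp
  then have "even m" by (metis dvd_refl even_power)
  then obtain k where "m = 2 * k" by blast
  with m2 have "2 * k\<^sup>2 = 1" by (simp add: power2_eq_square)
  then show False by presburger
qed

lemma rat_plus_sqrt2_eq_0:
  assumes "of_rat p + of_rat q / sqrt 2 = (0::real)"
  shows "p = 0 \<and> q = 0"
proof -
  have "of_rat q = - of_rat p * sqrt 2"
    using assms by (simp add: field_simps)
  then have "(of_rat q)\<^sup>2 = (of_rat p)\<^sup>2 * (2::real)"
    by (simp add: power_mult_distrib)
  then have "of_rat (q\<^sup>2) = (of_rat (p\<^sup>2 * 2) :: real)"
    by (simp add: of_rat_power of_rat_mult)
  then have eq: "q\<^sup>2 = p\<^sup>2 * 2" by (simp only: of_rat_eq_iff)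
  have "p = 0"
  proof (rule ccontr)
    assume "p \<noteq> 0"
    then have "(q / p)\<^sup>2 = 2" using eq by (simp add: power_divide)
    then show False using rat_square_neq_2 by blast
  qed
  with eq show ?thesis by simp
qed

lemma zcomb_eq_iff:
  "zcomb a b c d = zcomb a' b' c' d' \<longleftrightarrow> a = a' \<and> b = b' \<and> c = c' \<and> d = d'"
proof
  assume "zcomb a b c d = zcomb a' b' c' d'"
  then have "of_rat (a - a') + of_rat ((b - b') - (d - d')) / sqrt 2 = (0::real)"
    and "of_rat (c - c') + of_rat ((b - b') + (d - d')) / sqrt 2 = (0::real)"
    by (simp_all add: zcomb_Complex of_rat_diff of_rat_add diff_divide_distrib add_divide_distrib)
  from this[THEN rat_plus_sqrt2_eq_0]
  show "a = a' \<and> b = b' \<and> c = c' \<and> d = d'" by auto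
qed auto

lemma zcomb_add: "zcomb a b c d + zcomb a' b' c' d' = zcomb (a + a') (b + b') (c + c') (d + d')"
  by (simp add: zcomb_def of_rat_add algebra_simps)

lemma zcomb_mult:
  "zcomb a b c d * zcomb a' b' c' d' =
     zcomb (a*a' - b*d' - c*c' - d*b') (a*b' + b*a' - c*d' - d*c')
           (a*c' + b*b' + c*a' - d*d') (a*d' + b*c' + c*b' + d*a')"
proof -
  have "(A + B*z + C*z^2 + D*z^3) * (A' + B'*z + C'*z^2 + D'*z^3) =
     (A*A' - B*D' - C*C' - D*B') + (A*B' + B*A' - C*D' - D*C') * z +
     (A*C' + B*B' + C*A' - D*D') * z^2 + (A*D' + B*C' + C*B' + D*A') * z^3"
    if "z^4 = -1" for A B C D A' B' C' D' z :: complex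
    using that by algebra
  from this[OF zeta8_pow4] show ?thesis
    by (simp add: zcomb_def of_rat_add of_rat_diff of_rat_mult)
qed

lemma sigma8_ex1:
  "\<exists>!s. s \<in> extensional rat_zeta8 \<and> field_aut_on rat_zeta8 s \<and> s zeta8 = zeta8 ^ 3"
proof -
  define Q where "Q = (\<lambda>x (a, b, c, d). x = zcomb a b c d)"
  define s where "s = (\<lambda>x. if x \<in> rat_zeta8
    then (case SOME p. Q x p of (a, b, c, d) \<Rightarrow> zcomb a d (- c) b) else undefined)"
  have s_zcomb: "s (zcomb a b c d) = zcomb a d (- c) b" for a b c d
  proof -
    have "Q (zcomb a b c d) (SOME p. Q (zcomb a b c d) p)"
      by (rule someI[where x = "(a, b, c, d)"]) (simp add: Q_def)
    then have "(SOME p. Q (zcomb a b c d) p) = (a, b, c, d)"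
      by (auto simp: Q_def zcomb_eq_iff split: prod.splits)
    then show ?thesis by (simp add: s_def)
  qed
  have zeta: "zeta8 = zcomb 0 1 0 0" "zeta8 ^ 3 = zcomb 0 0 0 1"
    by (simp_all add: zcomb_def)
  have hom: "s (x + y) = s x + s y \<and> s (x * y) = s x * s y"
    if "x \<in> rat_zeta8" "y \<in> rat_zeta8" for x y
  proof -
    from that obtain a b c d a' b' c' d' where "x = zcomb a b c d" "y = zcomb a' b' c' d'"
      unfolding rat_zeta8_iff by blast
    then show ?thesis
      by (simp add: zcomb_add zcomb_mult s_zcomb zcomb_eq_iff algebra_simps)
  qed
  have bij: "bij_betw s rat_zeta8 rat_zeta8"
  proof (rule bij_betwI[where g = s])
    show "s \<in> rat_zeta8 \<rightarrow> rat_zeta8"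
      using s_zcomb by (force simp: rat_zeta8_iff)
    then show "s \<in> rat_zeta8 \<rightarrow> rat_zeta8" .
    show "s (s x) = x" if "x \<in> rat_zeta8" for x
      using that by (auto simp: rat_zeta8_iff s_zcomb)
    then show "s (s x) = x" if "x \<in> rat_zeta8" for x using that .
  qed
  have ex: "s \<in> extensional rat_zeta8 \<and> field_aut_on rat_zeta8 s \<and> s zeta8 = zeta8 ^ 3"
  proof (intro conjI)
    show "s \<in> extensional rat_zeta8" by (simp add: extensional_def s_def)
    show "field_aut_on rat_zeta8 s" using hom bij by (simp add: field_aut_on_def)
    show "s zeta8 = zeta8 ^ 3" unfolding zeta(2) by (simp add: zeta(1) s_zcomb)
  qed
  moreover have "t = s"
    if t: "t \<in> extensional rat_zeta8 \<and> field_aut_on rat_zeta8 t \<and> t zeta8 = zeta8 ^ 3" for t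
  proof
    fix x
    let ?K = rat_zeta8
    let ?q = "\<lambda>q. zcomb q 0 0 0"
    have rat: "?q q = of_rat q" for q by (simp add: zcomb_def)
    have K: "of_rat q \<in> ?K" for q by (metis rat zcomb_in)
    have K0: "0 \<in> ?K" "1 \<in> ?K" using K[of 0] K[of 1] by simp_all
    have add: "t (u + v) = t u + t v" and mult: "t (u * v) = t u * t v" if "u \<in> ?K" "v \<in> ?K" for u v
      using t that by (auto simp: field_aut_on_def)
    have inj: "inj_on t ?K" using t by (auto simp: field_aut_on_def bij_betw_def)
    have t0: "t 0 = 0" using add[OF K0(1) K0(1)] by simp
    have "t 1 \<noteq> 0" using inj K0 t0 by (metis inj_on_contraD zero_neq_one)
    then have t1: "t 1 = 1" using mult[OF K0(2) K0(2)] by simp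
    have tnat: "t (of_rat (of_nat n)) = of_rat (of_nat n)" for n
    proof (induction n)
      case (Suc n)
      have "t (of_rat (of_nat (Suc n))) = t (1 + of_rat (of_nat n))" by (simp add: of_rat_add)
      also have "\<dots> = t 1 + t (of_rat (of_nat n))" by (rule add[OF K0(2) K])
      finally show ?case using Suc t1 by (simp add: of_rat_add)
    qed (simp add: t0)
    have tneg: "t (of_rat (- q)) = - t (of_rat q)" for q
      using add[OF K[of q] K[of "- q"]] t0
      by (simp add: of_rat_minus) (metis add.commute add_eq_0_iff)
    have tint: "t (of_rat (of_int k)) = of_rat (of_int k)" for k
    proof (cases k rule: int_cases2)
      case (nonneg n)
      then show ?thesis using tnat[of n] by simp
    next
      case (nonpos n)
      then show ?thesis using tnat[of n] tneg[of "of_nat n"] by (simp add: of_rat_minus)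
    qed
    have trat: "t (of_rat q) = of_rat q" for q
    proof -
      obtain m n :: int where q: "q = of_int m / of_int n" "n > 0"
        by (metis Fract_of_int_quotient Rat_cases)
      have "of_rat q * of_rat (of_int n) = (of_rat (of_int m) :: complex)"
        using q by (simp add: of_rat_divide)
      then have "t (of_rat q) * of_rat (of_int n) = of_rat (of_int m)"
        using mult[OF K[of q] K[of "of_int n"]] by (simp only: tint)
      then have "t (of_rat q) = of_int m / of_int n"
        using q(2) by (simp add: eq_divide_eq)
      then show ?thesis by (simp add: q(1) of_rat_divide)
    qed
    have pw: "zeta8 = zcomb 0 1 0 0" "zeta8 ^ 2 = zcomb 0 0 1 0" "zeta8 ^ 3 = zcomb 0 0 0 1"
      by (simp_all add: zcomb_def)
    have Kz: "zeta8 \<in> ?K" "zeta8 ^ 2 \<in> ?K" "zeta8 ^ 3 \<in> ?K"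
      using pw zcomb_in by metis+
    have tz: "t zeta8 = zeta8 ^ 3" using t by blast
    have tz2: "t (zeta8 ^ 2) = zcomb 0 0 (- 1) 0"
    proof -
      have "t (zeta8 ^ 2) = zeta8 ^ 3 * zeta8 ^ 3"
        using mult[OF Kz(1) Kz(1)] by (simp add: power2_eq_square tz)
      then show ?thesis by (simp add: pw(3) zcomb_mult)
    qed
    have tz3: "t (zeta8 ^ 3) = zcomb 0 1 0 0"
    proof -
      have "zeta8 ^ 3 = zeta8 ^ 2 * zeta8" by (simp add: eval_nat_numeral)
      then have "t (zeta8 ^ 3) = zcomb 0 0 (- 1) 0 * zeta8 ^ 3"
        using mult[OF Kz(2) Kz(1)] by (simp add: tz tz2)
      then show ?thesis by (simp add: pw(3) zcomb_mult)
    qed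
    show "t x = s x"
    proof (cases "x \<in> ?K")
      case False
      then show ?thesis using t by (simp add: extensional_def s_def)
    next
      case True
      then obtain a b c d where x: "x = zcomb a b c d" unfolding rat_zeta8_iff by blast
      have m: "of_rat q * u \<in> ?K" if u: "u = zcomb 0 1 0 0 \<or> u = zcomb 0 0 1 0 \<or> u = zcomb 0 0 0 1" for q u
        using u by (auto simp flip: rat simp: zcomb_mult)
      have x1: "x = ((of_rat a + of_rat b * zeta8) + of_rat c * zeta8 ^ 2) + of_rat d * zeta8 ^ 3"
        by (simp add: x zcomb_def)
      have mem: "of_rat a + of_rat b * zeta8 \<in> ?K"
        "(of_rat a + of_rat b * zeta8) + of_rat c * zeta8 ^ 2 \<in> ?K"
        unfolding rat[symmetric] pw(2) by (simp_all add: pw(1) zcomb_mult zcomb_add)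
      have mb: "of_rat b * zeta8 \<in> ?K" "of_rat c * zeta8 ^ 2 \<in> ?K" "of_rat d * zeta8 ^ 3 \<in> ?K"
        using m pw by blast+
      have "t x = of_rat a + of_rat b * zeta8 ^ 3 + of_rat c * zcomb 0 0 (- 1) 0
          + of_rat d * zcomb 0 1 0 0"
        unfolding x1 add[OF mem(2) mb(3)] add[OF mem(1) mb(2)] add[OF K mb(1)]
          mult[OF K Kz(1)] mult[OF K Kz(2)] mult[OF K Kz(3)] trat tz tz2 tz3 ..
      also have "\<dots> = s x"
        unfolding x s_zcomb by (simp add: zcomb_def of_rat_minus)
      finally show ?thesis .
    qed
  qed
  ultimately show ?thesis by blast
qed

lemma sigma8:
  "sigma8 \<in> extensional rat_zeta8" "field_aut_on rat_zeta8 sigma8" "sigma8 zeta8 = zeta8 ^ 3"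
  using theI'[OF sigma8_ex1] by (simp_all add: sigma8_def)

end

theory Submission
  imports Defs
begin

text \<open>For \<open>x, y \<in> \<int>[\<zeta>]\<close> the number \<open>\<delta> = \<surd>2 Im (cnj x * y)\<close> lies in \<open>\<int>[\<surd>2]\<close>, and its conjugate is
  \<open>\<surd>2\<close> times the determinant of the conjugate points. If those lie in \<open>W\<close>, then
  \<open>\<bar>\<delta>'\<bar> < 2 \<surd>2 T\<^sub>W \<le> \<lambda>\<^bsup>m + 1\<^esup>\<close>. The only element of \<open>\<int>[\<surd>2]\<close> with \<open>\<bar>v\<bar> < 1\<close> and
  \<open>\<bar>v'\<bar> < \<lambda>\<close> is \<open>0\<close>; taking \<open>v = \<lambda>\<^bsup>m\<^esup> \<delta>\<close> shows that \<open>\<delta> \<noteq> 0\<close> forces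
  \<open>\<bar>\<delta>\<bar> \<ge> \<lambda>\<^bsup>- m\<^esup>\<close>, which bounds all gaps from below.

  Conversely a positive proportion of the gaps comes arbitrarily close to this bound. Fix
  \<open>w, w + v \<in> W\<close> with determinant \<open>\<plusminus> \<lambda>\<^bsup>m\<^esup> / \<surd>2\<close>. Primitive \<open>z\<close> with conjugate near \<open>v\<close> and
  \<open>\<bar>z\<bar> \<le> \<eta> T\<close> number at least a constant times \<open>T\<^sup>2\<close>, and each has some \<open>x\<close> with conjugate near \<open>w\<close> and
  \<open>\<bar>x\<bar>\<close> slightly less than \<open>T\<close> such that the pair \<open>x, x + z\<close> attains \<open>\<delta> = \<lambda>\<^bsup>- m\<^esup>\<close>. Different \<open>z\<close>
  give different directions of \<open>x\<close>.\<close>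

section \<open>The ring \<open>\<int>[\<surd>2]\<close>\<close>

text \<open>Only the weak limit of the gap distribution enters \<open>min_gap\<close>, so a single
  pair attaining the least determinant proves nothing: such pairs must account for a fixed fraction
  of all gaps, whose number is about \<theta> pi T^2. This forces a count of order T^2 of primitive
  vectors whose conjugates lie in a prescribed small box. Only a lower bound of the right order is
  needed, so crude lattice counts replace asymptotics.

  The points x have to be long because a determinant K between two points of length close to T
  belongs to an angle close to K / T^2, while shorter points give larger angles. With K =
  \<lambda>^(-m) / sqrt 2 the normalised gap tends to \<theta> pi T^2 * K / (2 pi T^2) = \<theta>
  \<lambda>^(-m) / (2 sqrt 2), which is where the constant comes from.

  The points of a pair need not be visible, since each ray through them contains a visible point.
  What has to be excluded is that many x share a ray, because one ray contributes one gap
  only.\<close>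

datatype quad = Quad (qre: int) (qim: int)

instantiation quad :: comm_ring_1
begin

definition "0 = Quad 0 0"
definition "1 = Quad 1 0"
definition "p + q = Quad (qre p + qre q) (qim p + qim q)"
definition "- p = Quad (- qre p) (- qim p)"
definition "p - q = Quad (qre p - qre q) (qim p - qim q)"
definition "p * q = Quad (qre p * qre q + 2 * qim p * qim q) (qre p * qim q + qim p * qre q)"

instance
  by standard
    (auto simp: zero_quad_def one_quad_def plus_quad_def uminus_quad_def minus_quad_def
      times_quad_def algebra_simps)

end

text \<open>The two real embeddings of a + b sqrt 2; their product is the norm. With formal pairs,
  conjugation is a function of the coordinates.\<close>

definition val :: "quad \<Rightarrow> real" where
  "val q = of_int (qre q) + of_int (qim q) * sqrt 2"

definition cval :: "quad \<Rightarrow> real" where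
  "cval q = of_int (qre q) - of_int (qim q) * sqrt 2"

lemma val_simps [simp]:
  "val 0 = 0" "val 1 = 1" "val (p + q) = val p + val q" "val (p - q) = val p - val q"
  "val (- p) = - val p" "val (p * q) = val p * val q"
  by (auto simp: val_def zero_quad_def one_quad_def plus_quad_def uminus_quad_def minus_quad_def
      times_quad_def algebra_simps)

lemma cval_simps [simp]:
  "cval 0 = 0" "cval 1 = 1" "cval (p + q) = cval p + cval q" "cval (p - q) = cval p - cval q"
  "cval (- p) = - cval p" "cval (p * q) = cval p * cval q"
  by (auto simp: cval_def zero_quad_def one_quad_def plus_quad_def uminus_quad_def minus_quad_def
      times_quad_def algebra_simps)

lemma val_power [simp]: "val (q ^ n) = val q ^ n"
  by (induction n) auto

lemma cval_power [simp]: "cval (q ^ n) = cval q ^ n"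
  by (induction n) auto

lemma val_mult_cval: "val q * cval q = of_int ((qre q)\<^sup>2 - 2 * (qim q)\<^sup>2)"
  by (simp add: val_def cval_def algebra_simps power2_eq_square)

lemma val_plus_cval: "val q + cval q = 2 * of_int (qre q)"
  and val_minus_cval: "val q - cval q = 2 * sqrt 2 * of_int (qim q)"
  by (simp_all add: val_def cval_def)

lemma int_sqrt2_eq_0_iff: "of_int a + of_int b * sqrt 2 = (0::real) \<longleftrightarrow> a = 0 \<and> b = 0"
proof
  assume "of_int a + of_int b * sqrt 2 = (0::real)"
  moreover have "of_rat (of_int (2 * b)) / sqrt 2 = real_of_int b * sqrt 2"
    by (simp add: of_rat_mult real_div_sqrt field_simps)
  ultimately have "of_rat (of_int a) + of_rat (of_int (2 * b)) / sqrt 2 = (0::real)"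
    by simp
  from rat_plus_sqrt2_eq_0[OF this] show "a = 0 \<and> b = 0" by simp
qed auto

lemma val_eq_0_iff [simp]: "val q = 0 \<longleftrightarrow> q = 0"
  using int_sqrt2_eq_0_iff[of "qre q" "qim q"] by (cases q) (auto simp: val_def zero_quad_def)

lemma cval_eq_0_iff [simp]: "cval q = 0 \<longleftrightarrow> q = 0"
  using int_sqrt2_eq_0_iff[of "qre q" "- qim q"] by (cases q) (auto simp: cval_def zero_quad_def)

lemma val_eq_iff: "val p = val q \<longleftrightarrow> p = q"
  using val_eq_0_iff[of "p - q"] by (simp del: val_eq_0_iff)

text \<open>The product is the absolute norm, an integer, and it is nonzero because sqrt 2 is
  irrational.\<close>

lemma norm_quad_ge_1:
  assumes "q \<noteq> 0"
  shows "\<bar>val q\<bar> * \<bar>cval q\<bar> \<ge> 1"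
proof -
  have "val q * cval q \<noteq> 0" using assms by simp
  then have "(qre q)\<^sup>2 - 2 * (qim q)\<^sup>2 \<noteq> 0" unfolding val_mult_cval by (metis of_int_0)
  then have "\<bar>(qre q)\<^sup>2 - 2 * (qim q)\<^sup>2\<bar> \<ge> 1" by linarith
  then have "real_of_int \<bar>(qre q)\<^sup>2 - 2 * (qim q)\<^sup>2\<bar> \<ge> 1" by (simp only: of_int_1_le_iff)
  then show ?thesis by (simp only: of_int_abs flip: abs_mult val_mult_cval)
qed

lemma quad_eq_0:
  assumes "\<bar>val q\<bar> * \<bar>cval q\<bar> < 1"
  shows "q = 0"
  using norm_quad_ge_1[of q] assms by fastforce

lemma sqrt2_bounds: "1.4 < sqrt (2::real)" "sqrt (2::real) < 1.5"
  by (rule real_less_rsqrt, simp add: power2_eq_square, rule real_less_lsqrt)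
     (simp_all add: power2_eq_square)

text \<open>The norm alone is too weak here, since the product of the two bounds exceeds 1. Both
  coordinates are confined to -1, 0, 1 and the candidates are checked. The bound \<open>lam\<close>
  is sharp: \<open>Quad (- 1) 1\<close> has value below 1 and a conjugate of absolute value
  \<open>lam\<close>.\<close>

lemma quad_small_eq_0:
  assumes "\<bar>val q\<bar> < 1" "\<bar>cval q\<bar> < lam"
  shows "q = 0"
proof -
  have l: "lam < 2.5" using sqrt2_bounds by (simp add: lam_def)
  have "\<bar>val q - cval q\<bar> < 3.5" "\<bar>val q + cval q\<bar> < 3.5" using assms l by linarith+
  then have 1: "2 * sqrt 2 * \<bar>real_of_int (qim q)\<bar> < 3.5" and 2: "2 * \<bar>real_of_int (qre q)\<bar> < 3.5"
    unfolding val_plus_cval val_minus_cval by (simp_all add: abs_mult)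
  have "\<bar>real_of_int (qre q)\<bar> < 2" using 2 by linarith
  then have a: "\<bar>qre q\<bar> < 2" by linarith
  have "\<bar>real_of_int (qim q)\<bar> < 2"
  proof (rule ccontr)
    assume "\<not> ?thesis"
    then have "2 * sqrt 2 * \<bar>real_of_int (qim q)\<bar> \<ge> 2 * sqrt 2 * 2"
      by (intro mult_left_mono) auto
    then show False using 1 sqrt2_bounds by linarith
  qed
  then have b: "\<bar>qim q\<bar> < 2" by linarith
  have ab: "qre q = -1 \<or> qre q = 0 \<or> qre q = 1" "qim q = -1 \<or> qim q = 0 \<or> qim q = 1"
    using a b by auto
  show ?thesis
    using assms ab sqrt2_bounds
    by (cases q) (auto simp: val_def cval_def lam_def zero_quad_def)
qed

section \<open>The unit 1 + sqrt 2 and its powers\<close>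

lemma lam_gt_1: "lam > 1" and lam_pos: "lam > 0" and lam_less: "lam < 2.5"
  using sqrt2_bounds by (auto simp: lam_def add_pos_pos)

lemma lam_inverse: "inverse lam = sqrt 2 - 1"
proof -
  have "lam * (sqrt 2 - 1) = 1" by (simp add: lam_def algebra_simps)
  then show ?thesis by (rule inverse_unique)
qed

text \<open>The ring has no division, so negative exponents become powers of sqrt 2 - 1, the inverse
  of \<lambda>.\<close>

definition lam_unit :: "int \<Rightarrow> quad" where
  "lam_unit k = (if k \<ge> 0 then Quad 1 1 ^ nat k else Quad (- 1) 1 ^ nat (- k))"

lemma val_lam_unit: "val (lam_unit k) = lam powi k"
proof -
  have "val (Quad 1 1) = lam" "val (Quad (-1) 1) = inverse lam"
    unfolding lam_inverse by (simp_all add: val_def lam_def)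
  then show ?thesis by (simp add: lam_unit_def power_int_def)
qed

lemma cval_lam_unit: "cval (lam_unit k) = (- inverse lam) powi k"
proof -
  have "cval (Quad 1 1) = - inverse lam" by (simp add: cval_def lam_inverse)
  moreover have "cval (Quad (-1) 1) = inverse (- inverse lam)"
    by (simp add: cval_def lam_def)
  ultimately show ?thesis by (simp add: lam_unit_def power_int_def)
qed

lemma abs_cval_lam_unit: "\<bar>cval (lam_unit k)\<bar> = lam powi (- k)"
  using lam_pos by (simp add: cval_lam_unit power_int_abs power_int_inverse power_int_minus)

lemma lam_unit_mult: "lam_unit k * lam_unit (- k) = 1"
proof -
  have "val (lam_unit k * lam_unit (- k)) = val 1"
    using lam_pos by (simp add: val_lam_unit power_int_minus)
  then show ?thesis by (simp only: val_eq_iff)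
qed

lemma lam_powi_bracket:
  assumes "y > 0"
  obtains k where "lam powi k \<le> y" "y < lam powi (k + 1)"
proof -
  define k where "k = \<lfloor>log lam y\<rfloor>"
  have e: "lam powi j = lam powr real_of_int j" for j :: int
    using lam_pos by (simp add: powr_real_of_int')
  have y: "lam powr log lam y = y" using assms lam_gt_1 lam_pos by simp
  have "lam powr real_of_int k \<le> lam powr log lam y"
    using lam_gt_1 by (intro powr_mono) (auto simp: k_def)
  moreover have "lam powr log lam y < lam powr real_of_int (k + 1)"
    using lam_gt_1 by (intro powr_less_mono) (auto simp: k_def; linarith)
  ultimately show ?thesis using that[of k] by (simp only: e y)
qed

section \<open>Euclidean division and primitive vectors\<close>

lemma quad_euclid:
  assumes "b \<noteq> 0"
  obtains q where "\<bar>val (a - q * b) * cval (a - q * b)\<bar> < \<bar>val b * cval b\<bar>"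
proof -
  \<comment> \<open>X and Y are the coordinates of the quotient in the field, recovered from its two
    embeddings. Rounding both leaves errors f and g of at most 1/2, and |f^2 - 2 g^2| \<le> 1/2 is
    the relative norm of the remainder.\<close>
  define X where "X = (val a / val b + cval a / cval b) / 2"
  define Y where "Y = (val a / val b - cval a / cval b) / (2 * sqrt 2)"
  define q where "q = Quad (round X) (round Y)"
  define f where "f = X - of_int (round X)"
  define g where "g = Y - of_int (round Y)"
  have fg: "\<bar>f\<bar> \<le> 1/2" "\<bar>g\<bar> \<le> 1/2"
    using of_int_round_abs_le[of X] of_int_round_abs_le[of Y] by (auto simp: f_def g_def abs_minus_commute)
  have nz: "val b \<noteq> 0" "cval b \<noteq> 0" using assms by auto
  have XY: "X + Y * sqrt 2 = val a / val b" "X - Y * sqrt 2 = cval a / cval b"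
    by (simp_all add: X_def Y_def field_simps)
  have 1: "val (a - q * b) = val b * (f + g * sqrt 2)"
  proof -
    have "f + g * sqrt 2 = val a / val b - val q"
      using XY(1) by (simp add: f_def g_def q_def val_def algebra_simps)
    then have "val b * (f + g * sqrt 2) = val b * (val a / val b) - val b * val q"
      by (simp add: right_diff_distrib)
    then show ?thesis using nz by simp
  qed
  have 2: "cval (a - q * b) = cval b * (f - g * sqrt 2)"
  proof -
    have "f - g * sqrt 2 = cval a / cval b - cval q"
      using XY(2) by (simp add: f_def g_def q_def cval_def algebra_simps)
    then have "cval b * (f - g * sqrt 2) = cval b * (cval a / cval b) - cval b * cval q"
      by (simp add: right_diff_distrib)
    then show ?thesis using nz by simp
  qed
  have "f\<^sup>2 \<le> (1/2)\<^sup>2" "g\<^sup>2 \<le> (1/2)\<^sup>2"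
    using fg abs_le_square_iff[of f "1/2"] abs_le_square_iff[of g "1/2"] by simp_all
  moreover have "(1/2)\<^sup>2 = (1/4::real)" by (simp add: power2_eq_square)
  ultimately have "\<bar>f\<^sup>2 - 2 * g\<^sup>2\<bar> < 1"
    using zero_le_power2[of f] zero_le_power2[of g] by linarith
  moreover have "val (a - q * b) * cval (a - q * b) = (val b * cval b) * (f\<^sup>2 - 2 * g\<^sup>2)"
    unfolding 1 2 by (simp add: algebra_simps power2_eq_square)
  ultimately have "\<bar>val (a - q * b) * cval (a - q * b)\<bar> < \<bar>val b * cval b\<bar>"
    using nz by (simp add: abs_mult mult_less_cancel_left1)
  then show ?thesis using that by blast
qed

definition qdet :: "quad \<times> quad \<Rightarrow> quad \<times> quad \<Rightarrow> quad" where
  "qdet p q = fst p * snd q - snd p * fst q"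

definition qscale :: "quad \<Rightarrow> quad \<times> quad \<Rightarrow> quad \<times> quad" where
  "qscale s p = (s * fst p, s * snd p)"

text \<open>Coprimality of the components, stated through a Bezout witness because
  \<open>partner_exists\<close> builds its solutions from that witness.\<close>

definition primitive :: "quad \<times> quad \<Rightarrow> bool" where
  "primitive p \<longleftrightarrow> (\<exists>q. qdet p q = 1)"

text \<open>Euclid's algorithm, by induction on the absolute norm of the second component; the
  Bezout coefficients are carried back along each division.\<close>

lemma content_primitive:
  obtains e z where "p = qscale e z" "primitive z"
proof -
  have "\<exists>e z. (a, b) = qscale e z \<and> primitive z" for a b
  proof (induction "nat \<bar>(qre b)\<^sup>2 - 2 * (qim b)\<^sup>2\<bar>" arbitrary: a b rule: less_induct)
    case less
    show ?case
    proof (cases "b = 0")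
      case True
      have "qdet (1, 0) (0, 1) = 1" by (simp add: qdet_def)
      then show ?thesis unfolding True primitive_def qscale_def
        by (intro exI[of _ a] exI[of _ "(1, 0)"]) auto
    next
      case False
      then obtain q where "\<bar>val (a - q * b) * cval (a - q * b)\<bar> < \<bar>val b * cval b\<bar>"
        by (rule quad_euclid)
      then have "nat \<bar>(qre (a - q * b))\<^sup>2 - 2 * (qim (a - q * b))\<^sup>2\<bar> < nat \<bar>(qre b)\<^sup>2 - 2 * (qim b)\<^sup>2\<bar>"
        unfolding val_mult_cval of_int_abs[symmetric] of_int_less_iff by linarith
      from less[OF this, of b] obtain e z w where "(b, a - q * b) = qscale e z" "qdet z w = 1"
        unfolding primitive_def by blast
      then obtain b1 r1 c d where
        *: "b = e * b1" "a - q * b = e * r1" "b1 * d - r1 * c = 1"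
        by (cases z; cases w) (auto simp: qscale_def qdet_def)
      have "a = e * (q * b1 + r1)" using *(1,2) by (simp add: algebra_simps)
      moreover have "(q * b1 + r1) * (- c) - b1 * (- d - q * c) = 1"
        using *(3) by (simp add: algebra_simps)
      ultimately show ?thesis unfolding primitive_def qdet_def qscale_def
        by (intro exI[of _ e] exI[of _ "(q * b1 + r1, b1)"] conjI exI[of _ "(- d - q * c, - c)"])
          (use *(1) in auto)
    qed
  qed
  then show ?thesis using that by (metis prod.collapse)
qed

lemma primitive_qscale_unit:
  assumes "primitive z" "u * v = 1"
  shows "primitive (qscale u z)"
proof -
  obtain q where "qdet z q = 1" using assms by (auto simp: primitive_def)
  moreover have "qdet (qscale u z) (qscale v q) = (u * v) * qdet z q"
    by (simp add: qdet_def qscale_def algebra_simps)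
  ultimately have "qdet (qscale u z) (qscale v q) = 1" using assms by simp
  then show ?thesis unfolding primitive_def by blast
qed

text \<open>There are infinitely many units, so e and z are far from unique. Moving a power of
  \<lambda> between them bounds \<open>cval e\<close>, and then only finitely many e have
  \<open>val e\<close> below a given bound.\<close>

lemma content_primitive_normalised:
  assumes "p \<noteq> 0"
  obtains e z where "p = qscale e z" "primitive z" "1 \<le> \<bar>cval e\<bar>" "\<bar>cval e\<bar> < lam"
proof -
  obtain e z where ez: "p = qscale e z" "primitive z" by (rule content_primitive)
  have "e \<noteq> 0" using ez assms by (auto simp: qscale_def zero_prod_def)
  then have pos: "\<bar>cval e\<bar> > 0" by simp
  then obtain k where k: "lam powi k \<le> \<bar>cval e\<bar>" "\<bar>cval e\<bar> < lam powi (k + 1)"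
    by (rule lam_powi_bracket)
  have c: "\<bar>cval (e * lam_unit k)\<bar> = \<bar>cval e\<bar> / lam powi k"
    using abs_cval_lam_unit[of k] by (simp add: abs_mult power_int_minus divide_inverse)
  have lk: "lam powi k > 0" using lam_pos by simp
  have "p = qscale (e * lam_unit k) (qscale (lam_unit (- k)) z)"
  proof -
    have "e * lam_unit k * (lam_unit (- k) * x) = e * x" for x
    proof -
      have "e * lam_unit k * (lam_unit (- k) * x) = e * (lam_unit k * lam_unit (- k)) * x"
        by (simp only: mult.assoc)
      then show ?thesis by (simp add: lam_unit_mult)
    qed
    then show ?thesis using ez(1) by (simp add: qscale_def)
  qed
  moreover have "primitive (qscale (lam_unit (- k)) z)"
    using ez(2) lam_unit_mult[of "- k"] by (intro primitive_qscale_unit) auto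
  moreover have "1 \<le> \<bar>cval (e * lam_unit k)\<bar>" "\<bar>cval (e * lam_unit k)\<bar> < lam"
    unfolding c using k lk lam_pos by (simp_all add: power_int_add field_simps)
  ultimately show ?thesis using that by blast
qed

section \<open>Counting in \<open>\<int>[\<surd>2]\<close>\<close>

lemma card_int_interval:
  fixes x l :: real
  assumes "l \<ge> 0"
  shows "finite {i::int. x \<le> of_int i \<and> of_int i \<le> x + l}"
    and "real (card {i::int. x \<le> of_int i \<and> of_int i \<le> x + l}) \<le> l + 1"
proof -
  have eq: "{i::int. x \<le> of_int i \<and> of_int i \<le> x + l} = {\<lceil>x\<rceil>..\<lfloor>x + l\<rfloor>}"
    by (auto simp: ceiling_le_iff le_floor_iff)
  show "finite {i::int. x \<le> of_int i \<and> of_int i \<le> x + l}" unfolding eq by simp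
  have "real_of_int (\<lfloor>x + l\<rfloor> - \<lceil>x\<rceil> + 1) \<le> l + 1"
    using of_int_floor_le[of "x + l"] le_of_int_ceiling[of x] unfolding of_int_add of_int_diff of_int_1 by linarith
  then show "real (card {i::int. x \<le> of_int i \<and> of_int i \<le> x + l}) \<le> l + 1"
    unfolding eq using assms by simp
qed

text \<open>The difference \<open>val q - cval q\<close> is 2 sqrt 2 times the second coordinate and
  confines it to an interval; then \<open>cval q\<close> confines the first. Counting both gives a
  bound linear in L.\<close>

lemma card_quad_window:
  fixes x L H :: real
  assumes "L \<ge> 0" "H \<ge> 0"
  shows "finite {q. x \<le> val q \<and> val q \<le> x + L \<and> \<bar>cval q\<bar> \<le> H}" (is "finite ?S")
    and "real (card {q. x \<le> val q \<and> val q \<le> x + L \<and> \<bar>cval q\<bar> \<le> H}) \<le> (2 * H + 1) * (L + 2 * H + 1)"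
proof -
  define y where "y = (x - H) / (2 * sqrt 2)"
  define l where "l = (L + 2 * H) / (2 * sqrt 2)"
  define B where "B = {i::int. y \<le> of_int i \<and> of_int i \<le> y + l}"
  define A where "A b = {i::int. of_int b * sqrt 2 - H \<le> of_int i \<and> of_int i \<le> of_int b * sqrt 2 - H + 2 * H}" for b :: int
  have l0: "l \<ge> 0" using assms by (simp add: l_def)
  have B: "finite B" "real (card B) \<le> l + 1"
    using card_int_interval[OF l0, of y] by (simp_all add: B_def)
  have A: "finite (A b)" "real (card (A b)) \<le> 2 * H + 1" for b
    using card_int_interval[of "2 * H" "of_int b * sqrt 2 - H"] assms by (simp_all add: A_def)
  have sub: "?S \<subseteq> (\<lambda>(b, a). Quad a b) ` (SIGMA b:B. A b)"
  proof
    fix q assume q: "q \<in> ?S"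
    have "x - H \<le> val q - cval q" "val q - cval q \<le> x + L + H"
      using q by auto
    then have "y \<le> of_int (qim q)" "of_int (qim q) \<le> y + l"
      unfolding val_minus_cval y_def l_def
      by (simp_all add: pos_divide_le_eq pos_le_divide_eq add_divide_distrib[symmetric] mult_ac)
    moreover have "qre q \<in> A (qim q)" using q by (auto simp: A_def cval_def abs_le_iff)
    ultimately have "(qim q, qre q) \<in> (SIGMA b:B. A b)" by (simp add: B_def)
    then show "q \<in> (\<lambda>(b, a). Quad a b) ` (SIGMA b:B. A b)" by force
  qed
  have fin: "finite (SIGMA b:B. A b)" using A B by auto
  show "finite ?S" using sub fin finite_surj by blast
  have "real (card ?S) \<le> real (card (SIGMA b:B. A b))"
    using surj_card_le[OF fin sub] by simp
  also have "\<dots> = (\<Sum>b\<in>B. real (card (A b)))" using A B by (simp add: card_SigmaI)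
  also have "\<dots> \<le> (\<Sum>b\<in>B. 2 * H + 1)" by (intro sum_mono A)
  also have "\<dots> = (2 * H + 1) * real (card B)" by simp
  also have "\<dots> \<le> (2 * H + 1) * (L + 2 * H + 1)"
  proof (intro mult_left_mono)
    have "l \<le> (L + 2 * H) / 1" unfolding l_def using assms sqrt2_bounds
      by (intro divide_left_mono) auto
    then show "real (card B) \<le> L + 2 * H + 1" using B by simp
  qed (use assms in auto)
  finally show "real (card ?S) \<le> (2 * H + 1) * (L + 2 * H + 1)" .
qed

lemma card_quad_box:
  fixes R H :: real
  assumes "R \<ge> 0" "H \<ge> 0"
  shows "finite {q. \<bar>val q\<bar> \<le> R \<and> \<bar>cval q\<bar> \<le> H}"
    and "real (card {q. \<bar>val q\<bar> \<le> R \<and> \<bar>cval q\<bar> \<le> H}) \<le> (2 * H + 1) * (2 * R + 2 * H + 1)"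
proof -
  have "{q. \<bar>val q\<bar> \<le> R \<and> \<bar>cval q\<bar> \<le> H} = {q. - R \<le> val q \<and> val q \<le> - R + 2 * R \<and> \<bar>cval q\<bar> \<le> H}"
    by auto
  then show "finite {q. \<bar>val q\<bar> \<le> R \<and> \<bar>cval q\<bar> \<le> H}"
    and "real (card {q. \<bar>val q\<bar> \<le> R \<and> \<bar>cval q\<bar> \<le> H}) \<le> (2 * H + 1) * (2 * R + 2 * H + 1)"
    using card_quad_window[of "2 * R" H "- R"] assms by simp_all
qed

lemma quad_square_window: "\<exists>q. x \<le> val q \<and> val q \<le> x + 3 \<and> y \<le> cval q \<and> cval q \<le> y + 3"
proof -
  \<comment> \<open>This b brings x - b sqrt 2 and y + b sqrt 2, the two lower bounds for the first
    coordinate, within sqrt 2 < 1.5 of each other. Rounding up the larger one exceeds the smaller by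
    at most 2.5.\<close>
  define b where "b = round ((x - y) / (2 * sqrt 2))"
  define M where "M = max (x - of_int b * sqrt 2) (y + of_int b * sqrt 2)"
  define a where "a = \<lceil>M\<rceil>"
  have "\<bar>(x - y) / (2 * sqrt 2) - of_int b\<bar> \<le> 1 / 2"
    using of_int_round_abs_le[of "(x - y) / (2 * sqrt 2)"] by (simp add: b_def abs_minus_commute)
  then have "\<bar>(x - y) / (2 * sqrt 2) - of_int b\<bar> * (2 * sqrt 2) \<le> 1 / 2 * (2 * sqrt 2)"
    by (rule mult_right_mono) simp
  also have "\<bar>(x - y) / (2 * sqrt 2) - of_int b\<bar> * (2 * sqrt 2) = \<bar>((x - y) / (2 * sqrt 2) - of_int b) * (2 * sqrt 2)\<bar>"
    by (simp add: abs_mult)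
  also have "((x - y) / (2 * sqrt 2) - of_int b) * (2 * sqrt 2) = x - y - 2 * (of_int b * sqrt 2)"
    proof -
    have "((x - y) / s - of_int b) * s = x - y - of_int b * s" if "s \<noteq> 0" for s :: real
      using that by (simp add: field_simps)
    from this[of "2 * sqrt 2"] show ?thesis by (simp add: mult_ac)
  qed
  finally have d: "\<bar>x - y - 2 * (of_int b * sqrt 2)\<bar> \<le> 1.5" using sqrt2_bounds by simp
  have a: "M \<le> of_int a" "of_int a \<le> M + 1" unfolding a_def by linarith+
  have "val (Quad a b) = of_int a + of_int b * sqrt 2" "cval (Quad a b) = of_int a - of_int b * sqrt 2"
    by (simp_all add: val_def cval_def)
  then show ?thesis using a d unfolding M_def
    by (intro exI[of _ "Quad a b"]) (simp add: max_def split: if_splits)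
qed

text \<open>Multiplication by a large power of \<lambda> stretches \<open>val\<close> and shrinks
  \<open>cval\<close> by the same factor, which turns a square of side 3 into a box of height at
  most h.\<close>

lemma quad_window:
  assumes "h > 0"
  shows "\<exists>L>0. \<forall>x y. \<exists>q. x \<le> val q \<and> val q \<le> x + L \<and> y \<le> cval q \<and> cval q \<le> y + h"
proof -
  obtain k where k: "3 / h < lam powi (k + 1)"
    using lam_powi_bracket[of "3 / h"] assms by (metis divide_pos_pos zero_less_numeral)
  define u where "u = lam_unit (k + 1)"
  define c where "c = cval u"
  have vu: "val u > 3 / h" "val u > 0" using k lam_pos by (simp_all add: u_def val_lam_unit)
  have "\<bar>c\<bar> = 1 / val u"
    unfolding c_def u_def abs_cval_lam_unit val_lam_unit power_int_minus by (simp add: divide_inverse)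
  then have c: "3 * \<bar>c\<bar> \<le> h" "c \<noteq> 0" using vu assms by (auto simp: field_simps)
  have "\<exists>q. x \<le> val q \<and> val q \<le> x + 3 * val u \<and> y \<le> cval q \<and> cval q \<le> y + h" for x y
  proof -
    \<comment> \<open>A negative \<open>cval u\<close> reverses the order, so the interval has to
      start from the image of its other end.\<close>
    define y0 where "y0 = (if c > 0 then y / c else (y + h) / c)"
    obtain q where q: "x / val u \<le> val q" "val q \<le> x / val u + 3" "y0 \<le> cval q" "cval q \<le> y0 + 3"
      using quad_square_window by blast
    have "x \<le> val (q * u)" using q(1) vu by (simp add: pos_divide_le_eq)
    moreover have "val (q * u) \<le> x + 3 * val u"
      using mult_right_mono[OF q(2), of "val u"] vu(2) by (simp add: distrib_right split: if_splits)
    moreover have "y \<le> cval (q * u) \<and> cval (q * u) \<le> y + h"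
    proof (cases "c > 0")
      case True
      then have "y \<le> cval q * c" "cval q * c \<le> y + 3 * c"
        using q by (simp_all add: y0_def field_simps)
      then show ?thesis using c True by (simp add: c_def)
    next
      case False
      then have "c < 0" using c by simp
      then have "cval q * c \<le> y0 * c" "(y0 + 3) * c \<le> cval q * c"
        using q by (intro mult_right_mono_neg; simp)+
      moreover have "y0 * c = y + h" using \<open>c < 0\<close> by (simp add: y0_def)
      ultimately
      have "cval q * c \<le> y + h" "y + h + 3 * c \<le> cval q * c"
        by (simp_all add: distrib_right)
      then show ?thesis using c \<open>c < 0\<close> by (simp add: c_def)
    qed
    ultimately show ?thesis by blast
  qed
  then show ?thesis using vu by (intro exI[of _ "3 * val u"]) simp
qed

lemma sum_inverse_squares_tail:
  assumes "K \<ge> 2"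
  shows "(\<Sum>n=K..M. 1 / (real n)\<^sup>2) \<le> 1 / (real K - 1)"
proof (cases "K \<le> M")
  case True
  \<comment> \<open>The extra \<open>- 1 / real M\<close> lets the induction telescope: 1 / (n +
    1)^2 \<le> 1 / n - 1 / (n + 1).\<close>
  then have "(\<Sum>n=K..M. 1 / (real n)\<^sup>2) \<le> 1 / (real K - 1) - 1 / real M"
  proof (induction M rule: dec_induct)
    case base
    have "real K \<ge> 2" using assms by simp
    then show ?case by (simp add: field_simps power2_eq_square)
  next
    case (step n)
    have n: "real n \<ge> 2" using step assms by simp
    have "1 / (real (Suc n))\<^sup>2 \<le> 1 / (real n * real (Suc n))"
      unfolding power2_eq_square using n by (intro divide_left_mono mult_right_mono) auto
    also have "\<dots> = 1 / real n - 1 / real (Suc n)" using n by (simp add: field_simps)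
    finally have "1 / (real (Suc n))\<^sup>2 \<le> 1 / real n - 1 / real (Suc n)" .
    then show ?case using step by simp
  qed
  moreover have "1 / real M \<ge> 0" by simp
  ultimately show ?thesis by linarith
next
  case False
  then show ?thesis using assms by simp
qed

section \<open>Primitive vectors have positive density\<close>

definition qbox :: "real \<Rightarrow> real \<Rightarrow> (quad \<times> quad) set" where
  "qbox R H = {q. \<bar>val q\<bar> \<le> R \<and> \<bar>cval q\<bar> \<le> H} \<times> {q. \<bar>val q\<bar> \<le> R \<and> \<bar>cval q\<bar> \<le> H}"

lemma finite_qbox: "R \<ge> 0 \<Longrightarrow> H \<ge> 0 \<Longrightarrow> finite (qbox R H)"
  unfolding qbox_def by (intro finite_cartesian_product card_quad_box)

lemma card_qbox:
  assumes "R \<ge> 1 / 4"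
  shows "real (card (qbox R 4)) \<le> (342 * R)\<^sup>2"
proof -
  have "real (card {q. \<bar>val q\<bar> \<le> R \<and> \<bar>cval q\<bar> \<le> 4}) \<le> 9 * (2 * R + 9)"
    using card_quad_box(2)[of R 4] assms by simp
  \<comment> \<open>The constant term 81 is at most 324 R because R \<ge> 1/4.\<close>
  also have "\<dots> \<le> 342 * R" using assms by simp
  finally show ?thesis unfolding qbox_def card_cartesian_product of_nat_mult power2_eq_square
    using assms by (intro mult_mono) auto
qed

text \<open>Every vector of the box is \<open>e z\<close> with \<open>z\<close> primitive and \<open>cval e\<close> bounded. As
  \<open>\<Sum> 1 / n\<^sup>2\<close> converges, the vectors with \<open>\<bar>val e\<bar>\<close> large form only a small proportion, so a
  finite set of factors \<open>e\<close> accounts for the rest.\<close>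

lemma primitive_coarse_count:
  "\<exists>c>0. \<forall>T\<ge>20. real (card {z \<in> qbox T 4. primitive z \<and> \<bar>cval (fst z)\<bar> \<ge> 1 / 3}) \<ge> c * T\<^sup>2"
proof -
  define P where "P T = {z \<in> qbox T 4. primitive z \<and> \<bar>cval (fst z)\<bar> \<ge> 1 / 3}" for T
  \<comment> \<open>Chosen so that the tail bound 84 * 342^2 * T^2 / (K - 1) equals T^2 / 128, half
    of the lower bound T^2 / 64 for \<open>card S\<close>.\<close>
  define K :: nat where "K = 1 + 84 * 128 * 342\<^sup>2"
  define E where "E = {e. \<bar>val e\<bar> \<le> real K \<and> \<bar>cval e\<bar> \<le> 2.5}"
  define F where "F n = {e. real n \<le> \<bar>val e\<bar> \<and> \<bar>val e\<bar> \<le> real n + 1 \<and> \<bar>cval e\<bar> \<le> 2.5}" for n :: nat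
  have finE: "finite E" unfolding E_def using card_quad_box(1)[of "real K" "2.5"] by simp
  have finP: "finite (P T)" if "T \<ge> 0" for T using finite_qbox[of T 4] that by (simp add: P_def)
  \<comment> \<open>One window of length 1 for each sign of \<open>val e\<close>, each with at most
    (2 * 2.5 + 1) * (1 + 2 * 2.5 + 1) = 42 elements.\<close>
  have F: "finite (F n)" "real (card (F n)) \<le> 84" for n
  proof -
    define F1 where "F1 = {q. real n \<le> val q \<and> val q \<le> real n + 1 \<and> \<bar>cval q\<bar> \<le> 2.5}"
    define F2 where "F2 = {q. - real n - 1 \<le> val q \<and> val q \<le> - real n - 1 + 1 \<and> \<bar>cval q\<bar> \<le> 2.5}"
    have f: "finite F1" "finite F2" "real (card F1) \<le> 42" "real (card F2) \<le> 42"
      unfolding F1_def F2_def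
      using card_quad_window[of 1 "2.5" "real n"] card_quad_window[of 1 "2.5" "- real n - 1"] by simp_all
    have sub: "F n \<subseteq> F1 \<union> F2" by (auto simp: F_def F1_def F2_def)
    then show "finite (F n)" using f finite_subset by blast
    have "card (F n) \<le> card F1 + card F2"
      using card_mono[OF _ sub] card_Un_le[of F1 F2] f by fastforce
    then show "real (card (F n)) \<le> 84" using f by linarith
  qed
  have main: "T\<^sup>2 / 128 \<le> real (card E) * real (card (P (5/2 * T)))" if T: "T \<ge> 8" for T
  proof -
    define M where "M = nat \<lfloor>4 * T\<rfloor>"
    \<comment> \<open>A first conjugate of at least 1 stays away from 0 after the factor e is
      removed. The first shear of \<open>primitive_count\<close> divides by it, and it makes
      \<open>fst z\<close> nonzero, which in turn bounds \<open>val e\<close>.\<close>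
    define S where "S = {x \<in> qbox T 4. cval (fst x) \<ge> 1}"
    have finS: "finite S" using finite_qbox[of T 4] T by (simp add: S_def)
    define n where "n = nat \<lfloor>T / 4\<rfloor>"
    have n: "real n \<le> T / 4" "real n \<ge> T / 8" unfolding n_def using T by linarith+
    \<comment> \<open>Windows of length 3 at spacing 4 are disjoint, so the chosen elements are
      distinct.\<close>
    have "\<forall>i. \<exists>q. 4 * real i \<le> val q \<and> val q \<le> 4 * real i + 3 \<and> 1 \<le> cval q \<and> cval q \<le> 1 + 3"
      using quad_square_window by blast
    then obtain g where g: "\<And>i. 4 * real i \<le> val (g i)" "\<And>i. val (g i) \<le> 4 * real i + 3"
      "\<And>i. 1 \<le> cval (g i)" "\<And>i. cval (g i) \<le> 4"
      by (auto simp: choice_iff)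
    have injg: "i = j" if "g i = g j" for i j :: nat
    proof -
      have "real i < real j + 1" "real j < real i + 1"
        using g(1)[of i] g(2)[of i] g(1)[of j] g(2)[of j] that by auto
      then show ?thesis by linarith
    qed
    have gT: "val (g i) \<le> T" "0 \<le> val (g i)" if "i < n" for i
    proof -
      have "real i + 1 \<le> real n" using that by linarith
      then show "val (g i) \<le> T" using g(2)[of i] n by linarith
      show "0 \<le> val (g i)" using g(1)[of i] by linarith
    qed
    have "(\<lambda>(i, j). (g i, g j)) ` ({..<n} \<times> {..<n}) \<subseteq> S"
      using gT g(3,4) by (auto simp: S_def qbox_def intro: order_trans[OF zero_le_one])
        (smt (verit) g(3))+
    moreover have "inj_on (\<lambda>(i, j). (g i, g j)) ({..<n} \<times> {..<n})"
      using injg by (auto simp: inj_on_def)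
    ultimately have "n * n \<le> card S"
      using card_inj_on_le[OF _ _ finS, of _ "{..<n} \<times> {..<n}"] by (simp add: card_cartesian_product)
    then have "real n * real n \<le> real (card S)" by (metis of_nat_le_iff of_nat_mult)
    moreover have "T / 8 * (T / 8) \<le> real n * real n" using n T by (intro mult_mono) auto
    ultimately have S1: "T\<^sup>2 / 64 \<le> real (card S)" by (simp add: power2_eq_square)
    have sub: "S \<subseteq> (\<lambda>(e, z). qscale e z) ` (E \<times> P (5/2 * T)) \<union>
        (\<Union>n\<in>{K..M}. (\<lambda>(e, z). qscale e z) ` (F n \<times> qbox (T / real n) 4))"
    proof
      fix x assume x: "x \<in> S"
      then have "x \<noteq> 0" by (auto simp: S_def)
      then obtain e z where ez: "x = qscale e z" "primitive z" "1 \<le> \<bar>cval e\<bar>" "\<bar>cval e\<bar> < lam"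
        by (rule content_primitive_normalised)
      have ce: "\<bar>cval e\<bar> \<le> 2.5" using ez lam_less by simp
      have xs: "\<bar>val e\<bar> * \<bar>val (fst z)\<bar> \<le> T" "\<bar>val e\<bar> * \<bar>val (snd z)\<bar> \<le> T"
        "\<bar>cval e\<bar> * \<bar>cval (fst z)\<bar> \<le> 4" "\<bar>cval e\<bar> * \<bar>cval (snd z)\<bar> \<le> 4"
        using x by (auto simp: S_def qbox_def ez(1) qscale_def abs_mult)
      have "cval e * cval (fst z) \<ge> 1" using x by (simp add: S_def ez(1) qscale_def)
      then have xs5: "\<bar>cval e\<bar> * \<bar>cval (fst z)\<bar> \<ge> 1" unfolding abs_mult[symmetric] by linarith
      have cz: "\<bar>cval (fst z)\<bar> \<le> 4" "\<bar>cval (snd z)\<bar> \<le> 4"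
        using xs(3,4) ez(3) mult_right_mono[OF ez(3), of "\<bar>cval (fst z)\<bar>"]
          mult_right_mono[OF ez(3), of "\<bar>cval (snd z)\<bar>"] by auto
      have cz1: "\<bar>cval (fst z)\<bar> \<ge> 2/5"
        using xs5 mult_right_mono[OF ce, of "\<bar>cval (fst z)\<bar>"] by auto
      have "e \<noteq> 0" "fst z \<noteq> 0" using ez(3) cz1 by auto
      then have N: "\<bar>val e\<bar> * \<bar>cval e\<bar> \<ge> 1" "\<bar>val (fst z)\<bar> * \<bar>cval (fst z)\<bar> \<ge> 1"
        using norm_quad_ge_1 by auto
      \<comment> \<open>The norm of e is at least 1 and its conjugate at most 2.5, so dividing by e
        enlarges values by a factor of at most 5/2.\<close>
      have ve: "\<bar>val e\<bar> \<ge> 2/5"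
        using N(1) mult_left_mono[OF ce, of "\<bar>val e\<bar>"] by auto
      have vz1: "\<bar>val (fst z)\<bar> \<ge> 1/4"
        using N(2) mult_left_mono[OF cz(1), of "\<bar>val (fst z)\<bar>"] by auto
      \<comment> \<open>Hence the shells \<open>F n\<close> with n \<le> 4 T suffice, and for these
        T / n \<ge> 1/4, as \<open>card_qbox\<close> requires.\<close>
      have ve4: "\<bar>val e\<bar> \<le> 4 * T"
        using xs(1) mult_left_mono[OF vz1, of "\<bar>val e\<bar>"] by auto
      show "x \<in> (\<lambda>(e, z). qscale e z) ` (E \<times> P (5/2 * T)) \<union>
        (\<Union>n\<in>{K..M}. (\<lambda>(e, z). qscale e z) ` (F n \<times> qbox (T / real n) 4))"
      proof (cases "\<bar>val e\<bar> \<le> real K")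
        case True
        have "\<bar>val (fst z)\<bar> \<le> 5/2 * T" "\<bar>val (snd z)\<bar> \<le> 5/2 * T"
          using xs(1,2) mult_right_mono[OF ve, of "\<bar>val (fst z)\<bar>"]
            mult_right_mono[OF ve, of "\<bar>val (snd z)\<bar>"] by auto
        then have "z \<in> P (5/2 * T)" using cz cz1 ez(2) by (cases z) (auto simp: P_def qbox_def)
        moreover have "e \<in> E" using True ce by (simp add: E_def)
        ultimately show ?thesis using ez(1) by force
      next
        case False
        define k where "k = nat \<lfloor>\<bar>val e\<bar>\<rfloor>"
        have k: "real k \<le> \<bar>val e\<bar>" "\<bar>val e\<bar> \<le> real k + 1" unfolding k_def by linarith+
        have kK: "k \<ge> K" "k \<le> M" using False ve4 unfolding k_def M_def by linarith+
        then have k0: "real k > 0" by (simp add: K_def)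
        have "real k * \<bar>val (fst z)\<bar> \<le> T" "real k * \<bar>val (snd z)\<bar> \<le> T"
          using xs(1,2) mult_right_mono[OF k(1), of "\<bar>val (fst z)\<bar>"]
            mult_right_mono[OF k(1), of "\<bar>val (snd z)\<bar>"] by auto
        then have "\<bar>val (fst z)\<bar> \<le> T / real k" "\<bar>val (snd z)\<bar> \<le> T / real k"
          using k0 by (simp_all add: field_simps)
        then have "z \<in> qbox (T / real k) 4" using cz by (cases z) (auto simp: qbox_def)
        moreover have "e \<in> F k" using k ce by (simp add: F_def)
        ultimately have "x \<in> (\<lambda>(e, z). qscale e z) ` (F k \<times> qbox (T / real k) 4)" using ez(1) by force
        then show ?thesis using kK by auto
      qed
    qed
    have finQ: "finite (qbox (T / real n) 4)" for n using T by (intro finite_qbox) auto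
    have finU: "finite (\<Union>n\<in>{K..M}. (\<lambda>(e, z). qscale e z) ` (F n \<times> qbox (T / real n) 4))"
      using F finQ by auto
    have finEP: "finite (E \<times> P (5/2 * T))" using finE finP T by auto
    have "card S \<le> card ((\<lambda>(e, z). qscale e z) ` (E \<times> P (5/2 * T))) +
        card (\<Union>n\<in>{K..M}. (\<lambda>(e, z). qscale e z) ` (F n \<times> qbox (T / real n) 4))"
      by (rule order_trans[OF card_mono[OF _ sub] card_Un_le]) (use finU finEP in auto)
    also have "\<dots> \<le> card E * card (P (5/2 * T)) + (\<Sum>n=K..M. card (F n) * card (qbox (T / real n) 4))"
    proof (rule add_mono)
      show "card ((\<lambda>(e, z). qscale e z) ` (E \<times> P (5/2 * T))) \<le> card E * card (P (5/2 * T))"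
        using card_image_le[OF finEP] by (simp add: card_cartesian_product)
      have "card (\<Union>n\<in>{K..M}. (\<lambda>(e, z). qscale e z) ` (F n \<times> qbox (T / real n) 4)) \<le>
          (\<Sum>n=K..M. card ((\<lambda>(e, z). qscale e z) ` (F n \<times> qbox (T / real n) 4)))"
        by (rule card_UN_le) simp
      also have "\<dots> \<le> (\<Sum>n=K..M. card (F n \<times> qbox (T / real n) 4))"
        using F finQ by (intro sum_mono card_image_le) auto
      finally show "card (\<Union>n\<in>{K..M}. (\<lambda>(e, z). qscale e z) ` (F n \<times> qbox (T / real n) 4)) \<le>
          (\<Sum>n=K..M. card (F n) * card (qbox (T / real n) 4))"
        by (simp add: card_cartesian_product)
    qed
    finally have "real (card S) \<le> real (card E * card (P (5/2 * T)) +
        (\<Sum>n=K..M. card (F n) * card (qbox (T / real n) 4)))"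
      by (simp only: of_nat_le_iff)
    also have "\<dots> = real (card E) * real (card (P (5/2 * T))) +
        (\<Sum>n=K..M. real (card (F n)) * real (card (qbox (T / real n) 4)))"
      by simp
    also have "(\<Sum>n=K..M. real (card (F n)) * real (card (qbox (T / real n) 4))) \<le>
        (\<Sum>n=K..M. 84 * (342\<^sup>2 * T\<^sup>2) * (1 / (real n)\<^sup>2))"
    proof (rule sum_mono)
      fix n assume "n \<in> {K..M}"
      then have nM: "n \<le> M" and n0: "real n > 0" by (auto simp: K_def)
      have "real n \<le> 4 * T" using nM T unfolding M_def by linarith
      then have "T / real n \<ge> 1 / 4" using n0 by (simp add: field_simps)
      then have "real (card (qbox (T / real n) 4)) \<le> (342 * (T / real n))\<^sup>2" by (rule card_qbox)
      then have "real (card (F n)) * real (card (qbox (T / real n) 4)) \<le> 84 * (342 * (T / real n))\<^sup>2"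
        using F(2)[of n] by (intro mult_mono) auto
      then show "real (card (F n)) * real (card (qbox (T / real n) 4)) \<le> 84 * (342\<^sup>2 * T\<^sup>2) * (1 / (real n)\<^sup>2)"
        by (simp add: power_mult_distrib power_divide)
    qed
    also have "(\<Sum>n=K..M. 84 * (342\<^sup>2 * T\<^sup>2) * (1 / (real n)\<^sup>2)) =
        84 * (342\<^sup>2 * T\<^sup>2) * (\<Sum>n=K..M. 1 / (real n)\<^sup>2)"
      by (simp only: sum_distrib_left)
    also have "\<dots> \<le> 84 * (342\<^sup>2 * T\<^sup>2) * (1 / (real K - 1))"
      by (intro mult_left_mono sum_inverse_squares_tail) (auto simp: K_def)
    also have "\<dots> = T\<^sup>2 / 128" by (simp add: K_def)
    finally show ?thesis using S1 by linarith
  qed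
  define c where "c = 1 / (128 * (real (card E) + 1) * (5/2)\<^sup>2)"
  have "c * T\<^sup>2 \<le> real (card (P T))" if "T \<ge> 20" for T
  proof -
    have "(2/5 * T)\<^sup>2 / 128 \<le> real (card E) * real (card (P T))"
      using main[of "2/5 * T"] that by simp
    also have "\<dots> \<le> (real (card E) + 1) * real (card (P T))" by (intro mult_right_mono) auto
    finally show ?thesis by (simp add: c_def field_simps power2_eq_square)
  qed
  moreover have "c > 0" by (simp add: c_def add_nonneg_pos)
  ultimately show ?thesis unfolding P_def by blast
qed

text \<open>Two shears, taken from a finite set, move the conjugate of any vector of the coarse count
  into the prescribed box.\<close>

lemma primitive_count:
  assumes "r > 0"
  shows "\<exists>c>0. \<exists>T0. \<forall>T\<ge>T0. real (card {z. primitive z \<and> \<bar>val (fst z)\<bar> \<le> T \<and> \<bar>val (snd z)\<bar> \<le> T \<and>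
    \<bar>cval (fst z) - v1\<bar> < r \<and> \<bar>cval (snd z) - v2\<bar> < r}) \<ge> c * T\<^sup>2"
proof -
  define G where "G T = {z. primitive z \<and> \<bar>val (fst z)\<bar> \<le> T \<and> \<bar>val (snd z)\<bar> \<le> T \<and>
        \<bar>cval (fst z) - v1\<bar> < r \<and> \<bar>cval (snd z) - v2\<bar> < r}" for T
  have finG: "finite (G T)" if "T \<ge> 0" for T
  proof -
    have "G T \<subseteq> qbox T (\<bar>v1\<bar> + \<bar>v2\<bar> + r)"
    proof
      fix z assume z: "z \<in> G T"
      have "\<bar>cval (fst z)\<bar> \<le> \<bar>v1\<bar> + \<bar>v2\<bar> + r" "\<bar>cval (snd z)\<bar> \<le> \<bar>v1\<bar> + \<bar>v2\<bar> + r"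
        using z unfolding G_def by (auto; linarith)+
      then show "z \<in> qbox T (\<bar>v1\<bar> + \<bar>v2\<bar> + r)"
        using z by (cases z) (simp add: G_def qbox_def)
    qed
    moreover have "finite (qbox T (\<bar>v1\<bar> + \<bar>v2\<bar> + r))" using that assms by (intro finite_qbox) auto
    ultimately show ?thesis by (rule finite_subset)
  qed
  \<comment> \<open>The second shear divides by the conjugate of the second component, so the target
    of that component must not be 0; it is displaced by r / 2 if v2 = 0.\<close>
  define w2 where "w2 = (if v2 = 0 then r / 2 else v2)"
  define \<rho> where "\<rho> = min (r / 2) (\<bar>w2\<bar> / 2)"
  have w2: "w2 \<noteq> 0" "\<bar>w2 - v2\<bar> \<le> r / 2" and \<rho>: "\<rho> > 0" "\<rho> \<le> r / 2" "\<rho> \<le> \<bar>w2\<bar> / 2"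
    using assms by (auto simp: w2_def \<rho>_def)
  \<comment> \<open>An overshoot h1 of the first multiplier is multiplied by at most 4, an error of
    at most \<rho> / 2. The overshoot h2 is multiplied by at most |w2| + \<rho>, an error of at most
    r / 2.\<close>
  define h1 where "h1 = \<rho> / 8"
  define h2 where "h2 = r / (2 * (\<bar>w2\<bar> + \<rho>))"
  have h: "h1 > 0" "h2 > 0" using \<rho> assms by (auto simp: h1_def h2_def intro!: divide_pos_pos)
  obtain L1 where L1: "L1 > 0" "\<And>x y. \<exists>q. x \<le> val q \<and> val q \<le> x + L1 \<and> y \<le> cval q \<and> cval q \<le> y + h1"
    using quad_window[OF h(1)] by blast
  obtain L2 where L2: "L2 > 0" "\<And>x y. \<exists>q. x \<le> val q \<and> val q \<le> x + L2 \<and> y \<le> cval q \<and> cval q \<le> y + h2"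
    using quad_window[OF h(2)] by blast
  define B1 where "B1 = 3 * (\<bar>w2\<bar> + 4) + h1"
  define B2 where "B2 = (\<bar>v1\<bar> + 4) / (\<bar>w2\<bar> / 2) + h2"
  define S1 where "S1 = {q. \<bar>val q\<bar> \<le> L1 \<and> \<bar>cval q\<bar> \<le> B1}"
  define S2 where "S2 = {q. \<bar>val q\<bar> \<le> L2 \<and> \<bar>cval q\<bar> \<le> B2}"
  have fin12: "finite S1" "finite S2" unfolding S1_def S2_def
    using L1 L2 h by (auto intro!: card_quad_box simp: B1_def B2_def)
  define M where "M = (1 + L1) * (1 + L2)"
  have M1: "M \<ge> 1" using L1 L2 by (simp add: M_def algebra_simps)
  define C where "C T = {z \<in> qbox T 4. primitive z \<and> \<bar>cval (fst z)\<bar> \<ge> 1 / 3}" for T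
  obtain c where c: "c > 0" "\<And>T. T \<ge> 20 \<Longrightarrow> real (card (C T)) \<ge> c * T\<^sup>2"
    using primitive_coarse_count unfolding C_def by blast
  \<comment> \<open>Inverse of the two shears. Hence each vector of G comes from at most
    \<open>card (S2 \<times> S1)\<close> coarse vectors.\<close>
  define unshear where "unshear = (\<lambda>((s :: quad, t), z). (fst z - s * snd z, snd z - t * (fst z - s * snd z)))"
  have sub: "C T \<subseteq> unshear ` ((S2 \<times> S1) \<times> G (M * T))" if T: "T \<ge> 0" for T
  proof
    fix z assume z: "z \<in> C T"
    define a where "a = cval (fst z)"
    define b where "b = cval (snd z)"
    have ab: "\<bar>a\<bar> \<le> 4" "\<bar>b\<bar> \<le> 4" "\<bar>a\<bar> \<ge> 1/3" using z by (auto simp: a_def b_def C_def qbox_def)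
    \<comment> \<open>The real multiplier that would hit w2 exactly; the conjugate of t approximates
      it from above.\<close>
    define \<tau> where "\<tau> = (w2 - b) / a"
    obtain t where t: "0 \<le> val t" "val t \<le> L1" "\<tau> \<le> cval t" "cval t \<le> \<tau> + h1"
      using L1(2)[of 0 \<tau>] by auto
    have "\<bar>\<tau>\<bar> \<le> (\<bar>w2\<bar> + 4) / (1/3)" unfolding \<tau>_def abs_divide
      using ab by (intro frac_le) auto
    then have "t \<in> S1" using t by (auto simp: S1_def B1_def)
    define w where "w = snd z + t * fst z"
    have "\<tau> * a = w2 - b" using ab by (auto simp: \<tau>_def)
    then have "cval w - w2 = (cval t - \<tau>) * a" by (simp add: w_def a_def b_def algebra_simps)
    then have "\<bar>cval w - w2\<bar> \<le> h1 * 4" using t ab by (simp add: abs_mult mult_mono)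
    then have cw: "\<bar>cval w - w2\<bar> < \<rho>" using \<rho> by (simp add: h1_def)
    then have cw': "\<bar>cval w - v2\<bar> < r" "\<bar>cval w\<bar> \<ge> \<bar>w2\<bar> / 2" "\<bar>cval w\<bar> \<le> \<bar>w2\<bar> + \<rho>" "cval w \<noteq> 0"
      using w2 \<rho> by linarith+
    define \<sigma> where "\<sigma> = (v1 - a) / cval w"
    obtain s where s: "0 \<le> val s" "val s \<le> L2" "\<sigma> \<le> cval s" "cval s \<le> \<sigma> + h2"
      using L2(2)[of 0 \<sigma>] by auto
    have "\<bar>v1 - a\<bar> \<le> \<bar>v1\<bar> + 4" using ab by linarith
    then have "\<bar>\<sigma>\<bar> \<le> (\<bar>v1\<bar> + 4) / (\<bar>w2\<bar> / 2)" unfolding \<sigma>_def abs_divide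
      using ab cw' w2 by (intro frac_le) auto
    then have "s \<in> S2" using s by (auto simp: S2_def B2_def)
    define y where "y = fst z + s * w"
    have "\<sigma> * cval w = v1 - a" using cw' by (simp add: \<sigma>_def)
    then have "cval y - v1 = (cval s - \<sigma>) * cval w" by (simp add: y_def a_def algebra_simps)
    then have "\<bar>cval y - v1\<bar> \<le> h2 * (\<bar>w2\<bar> + \<rho>)" using s cw' by (simp add: abs_mult mult_mono)
    also have "\<dots> = r / 2"
    proof -
      have "r / (2 * x) * x = r / 2" if "x > 0" for x :: real using that by simp
      from this[of "\<bar>w2\<bar> + \<rho>"] show ?thesis using \<rho> by (simp add: h2_def)
    qed
    finally have cy: "\<bar>cval y - v1\<bar> < r" using assms by simp
    have vz: "\<bar>val (fst z)\<bar> \<le> T" "\<bar>val (snd z)\<bar> \<le> T" using z by (auto simp: C_def qbox_def)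
    have "\<bar>val t * val (fst z)\<bar> \<le> L1 * T" unfolding abs_mult using t vz L1 by (intro mult_mono) auto
    then have vw: "\<bar>val w\<bar> \<le> (1 + L1) * T" using vz by (simp add: w_def distrib_right)
    have "\<bar>val s * val w\<bar> \<le> L2 * ((1 + L1) * T)" unfolding abs_mult using s vw L2 by (intro mult_mono) auto
    then have "\<bar>val y\<bar> \<le> T + L2 * ((1 + L1) * T)" using vz by (simp add: y_def)
    also have "\<dots> \<le> M * T" using L1 L2 T by (simp add: M_def algebra_simps)
    finally have vy: "\<bar>val y\<bar> \<le> M * T" .
    have "(1 + L1) * T \<le> M * T" using L1 L2 T by (intro mult_right_mono) (auto simp: M_def)
    then have vw': "\<bar>val w\<bar> \<le> M * T" using vw by simp
    obtain q where q: "qdet z q = 1" using z by (auto simp: C_def primitive_def)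
    \<comment> \<open>Applying the same shears to the Bezout witness preserves the
      determinant.\<close>
    have "qdet (y, w) (fst q + s * (snd q + t * fst q), snd q + t * fst q) = qdet z q"
      by (simp add: qdet_def y_def w_def algebra_simps)
    then have "primitive (y, w)" using q by (auto simp: primitive_def)
    then have "(y, w) \<in> G (M * T)" using vy vw' cy cw' by (simp add: G_def)
    moreover have "z = unshear ((s, t), (y, w))" by (simp add: unshear_def y_def w_def)
    ultimately show "z \<in> unshear ` ((S2 \<times> S1) \<times> G (M * T))" using \<open>t \<in> S1\<close> \<open>s \<in> S2\<close> by blast
  qed
  define d where "d = real (card (S2 \<times> S1)) + 1"
  have d: "d > 0" by (simp add: d_def)
  have "c / (d * M\<^sup>2) * T\<^sup>2 \<le> real (card (G T))" if T: "T \<ge> 20 * M" for T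
  proof -
    have TM: "T / M \<ge> 20" using T M1 by (simp add: field_simps)
    have "c * (T / M)\<^sup>2 \<le> real (card (C (T / M)))" using c TM by blast
    also have "\<dots> \<le> real (card ((S2 \<times> S1) \<times> G (M * (T / M))))"
      unfolding of_nat_le_iff
      using surj_card_le[OF _ sub[of "T / M"]] fin12 finG[of T] TM T M1 by simp
    also have "\<dots> = real (card (S2 \<times> S1)) * real (card (G T))"
      using M1 by (simp add: card_cartesian_product)
    also have "\<dots> \<le> d * real (card (G T))" unfolding d_def by (intro mult_right_mono) auto
    finally show ?thesis using d M1 by (simp add: field_simps power_divide)
  qed
  moreover have "c / (d * M\<^sup>2) > 0" using c d M1 by simp
  ultimately show ?thesis unfolding G_def by blast
qed

section \<open>The two embeddings of \<open>\<int>[\<zeta>]\<close>\<close>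

text \<open>The pair \<open>(a, b)\<close> stands for \<open>a + b \<zeta>\<close>: the elements \<open>1, \<zeta>\<close> form a basis of \<open>\<int>[\<zeta>]\<close>
  over \<open>\<int>[\<surd>2]\<close>.\<close>

definition emb :: "quad \<times> quad \<Rightarrow> complex" where
  "emb p = of_real (val (fst p)) + of_real (val (snd p)) * zeta8"

text \<open>The automorphism sends sqrt 2 = zeta - zeta^3 to its negative, whence
  \<open>cval\<close>, and zeta to zeta^3.\<close>

definition cemb :: "quad \<times> quad \<Rightarrow> complex" where
  "cemb p = of_real (cval (fst p)) + of_real (cval (snd p)) * zeta8 ^ 3"

lemma zeta8_cube: "zeta8 ^ 3 = Complex (- 1 / sqrt 2) (1 / sqrt 2)"
proof -
  have "zeta8 ^ 3 = zeta8 ^ 2 * zeta8" by (simp add: eval_nat_numeral)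
  then show ?thesis unfolding zeta8_sq by (simp add: zeta8_eq complex_eq_iff)
qed

lemma emb_add: "emb (p + q) = emb p + emb q"
  and emb_diff: "emb (p - q) = emb p - emb q"
  and emb_qscale: "emb (qscale s p) = of_real (val s) * emb p"
  and cemb_add: "cemb (p + q) = cemb p + cemb q"
  and cemb_diff: "cemb (p - q) = cemb p - cemb q"
  and cemb_qscale: "cemb (qscale s p) = of_real (cval s) * cemb p"
  by (simp_all add: emb_def cemb_def qscale_def algebra_simps)

lemma Im_cnj_mult_basis:
  assumes "Im w = 1 / sqrt 2"
  shows "Im (cnj (of_real a + of_real b * w) * (of_real c + of_real d * w)) = (a * d - b * c) / sqrt 2"
  using assms by (simp add: algebra_simps diff_divide_distrib)

text \<open>Both zeta and its cube have imaginary part 1 / sqrt 2, so the planar determinants in the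
  two embeddings are conjugate numbers divided by sqrt 2. This couples angles between points to
  areas spanned in the window.\<close>

lemma Im_emb: "Im (cnj (emb p) * emb q) = val (qdet p q) / sqrt 2"
  unfolding emb_def qdet_def by (subst Im_cnj_mult_basis) (simp_all add: zeta8_eq)

lemma Im_cemb: "Im (cnj (cemb p) * cemb q) = cval (qdet p q) / sqrt 2"
  unfolding cemb_def qdet_def by (subst Im_cnj_mult_basis) (simp_all add: zeta8_cube)

lemma basis_coordinate_bounds:
  assumes "Im w = 1 / sqrt 2" "norm w = 1"
  shows "\<bar>b\<bar> \<le> 2 * norm (of_real a + of_real b * w)" "\<bar>a\<bar> \<le> 3 * norm (of_real a + of_real b * w)"
proof -
  let ?z = "of_real a + of_real b * w"
  have "\<bar>b\<bar> / sqrt 2 = \<bar>Im ?z\<bar>" using assms by (simp add: abs_mult)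
  also have "\<dots> \<le> norm ?z" by (rule abs_Im_le_cmod)
  finally have "\<bar>b\<bar> \<le> sqrt 2 * norm ?z" by (simp add: field_simps)
  also have "\<dots> \<le> 2 * norm ?z" using sqrt2_bounds by (intro mult_right_mono) auto
  finally show b: "\<bar>b\<bar> \<le> 2 * norm ?z" .
  have "\<bar>a\<bar> = norm (?z - of_real b * w)" by simp
  also have "\<dots> \<le> norm ?z + \<bar>b\<bar>"
    using norm_triangle_ineq4[of ?z "of_real b * w"] assms by (simp add: norm_mult)
  finally show "\<bar>a\<bar> \<le> 3 * norm ?z" using b by simp
qed

lemma norm_zeta8: "norm zeta8 = 1"
  by (simp add: zeta8_def)

lemma emb_bounds: "\<bar>val (fst p)\<bar> \<le> 3 * norm (emb p)" "\<bar>val (snd p)\<bar> \<le> 3 * norm (emb p)"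
  and norm_emb_le: "norm (emb p) \<le> \<bar>val (fst p)\<bar> + \<bar>val (snd p)\<bar>"
proof -
  have "Im zeta8 = 1 / sqrt 2" by (simp add: zeta8_eq)
  note * = basis_coordinate_bounds[OF this norm_zeta8, where a = "val (fst p)" and b = "val (snd p)", folded emb_def]
  then show "\<bar>val (fst p)\<bar> \<le> 3 * norm (emb p)" "\<bar>val (snd p)\<bar> \<le> 3 * norm (emb p)"
    using norm_ge_zero[of "emb p"] by linarith+
  show "norm (emb p) \<le> \<bar>val (fst p)\<bar> + \<bar>val (snd p)\<bar>"
    unfolding emb_def by (rule norm_triangle_le) (simp add: norm_mult norm_zeta8)
qed

lemma cemb_bounds: "\<bar>cval (fst p)\<bar> \<le> 3 * norm (cemb p)" "\<bar>cval (snd p)\<bar> \<le> 3 * norm (cemb p)"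
proof -
  have "Im (zeta8 ^ 3) = 1 / sqrt 2" "norm (zeta8 ^ 3) = 1"
    by (simp_all add: zeta8_cube[THEN arg_cong[where f = Im]] norm_power norm_zeta8)
  note * = basis_coordinate_bounds[OF this, where a = "cval (fst p)" and b = "cval (snd p)", folded cemb_def]
  then show "\<bar>cval (fst p)\<bar> \<le> 3 * norm (cemb p)" "\<bar>cval (snd p)\<bar> \<le> 3 * norm (cemb p)"
    using norm_ge_zero[of "cemb p"] by linarith+
qed

lemma norm_cemb_diff_le:
  "norm (cemb p - (of_real a + of_real b * zeta8 ^ 3)) \<le> \<bar>cval (fst p) - a\<bar> + \<bar>cval (snd p) - b\<bar>"
proof -
  have "cemb p - (of_real a + of_real b * zeta8 ^ 3)
      = of_real (cval (fst p) - a) + of_real (cval (snd p) - b) * zeta8 ^ 3"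
    by (simp add: cemb_def algebra_simps)
  also have "norm \<dots> \<le> \<bar>cval (fst p) - a\<bar> + \<bar>cval (snd p) - b\<bar>"
    by (rule norm_triangle_le) (simp add: norm_mult norm_power norm_zeta8 del: of_real_diff)
  finally show ?thesis .
qed

lemma cemb_basis: obtains a b where "z = of_real a + of_real b * zeta8 ^ 3"
proof
  show "z = of_real (Re z + Im z) + of_real (Im z * sqrt 2) * zeta8 ^ 3"
    by (simp add: zeta8_cube complex_eq_iff)
qed

text \<open>Some coordinate is nonzero and has absolute norm at least 1, and each embedding controls
  the coordinates up to a factor 3. Thus a bounded conjugate keeps a nonzero point away from the
  origin.\<close>

lemma norm_emb_cemb_ge:
  assumes "p \<noteq> 0"
  shows "9 * (norm (emb p) * norm (cemb p)) \<ge> 1"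
proof -
  have "fst p \<noteq> 0 \<or> snd p \<noteq> 0" using assms by (auto simp: prod_eq_iff)
  then have "1 \<le> (3 * norm (emb p)) * (3 * norm (cemb p))"
  proof
    assume "fst p \<noteq> 0"
    then have "1 \<le> \<bar>val (fst p)\<bar> * \<bar>cval (fst p)\<bar>" by (rule norm_quad_ge_1)
    also have "\<dots> \<le> (3 * norm (emb p)) * (3 * norm (cemb p))"
      by (intro mult_mono emb_bounds cemb_bounds) auto
    finally show ?thesis .
  next
    assume "snd p \<noteq> 0"
    then have "1 \<le> \<bar>val (snd p)\<bar> * \<bar>cval (snd p)\<bar>" by (rule norm_quad_ge_1)
    also have "\<dots> \<le> (3 * norm (emb p)) * (3 * norm (cemb p))"
      by (intro mult_mono emb_bounds cemb_bounds) auto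
    finally show ?thesis .
  qed
  then show ?thesis by simp
qed

lemma emb_eq_0_iff: "emb p = 0 \<longleftrightarrow> p = 0"
proof
  assume "emb p = 0"
  then show "p = 0" using norm_emb_cemb_ge[of p] by force
qed (simp add: emb_def)

lemma emb_inject: "emb p = emb q \<longleftrightarrow> p = q"
  using emb_eq_0_iff[of "p - q"] by (simp add: emb_diff)

lemma finite_emb_cemb_bounded: "finite {p. norm (emb p) \<le> R \<and> norm (cemb p) \<le> H}"
proof -
  let ?B = "{q. \<bar>val q\<bar> \<le> 3 * \<bar>R\<bar> \<and> \<bar>cval q\<bar> \<le> 3 * \<bar>H\<bar>}"
  have "{p. norm (emb p) \<le> R \<and> norm (cemb p) \<le> H} \<subseteq> ?B \<times> ?B"
  proof
    fix p assume "p \<in> {p. norm (emb p) \<le> R \<and> norm (cemb p) \<le> H}"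
    then show "p \<in> ?B \<times> ?B" using emb_bounds[of p] cemb_bounds[of p] by (cases p) auto
  qed
  moreover have "finite ?B" by (intro card_quad_box) auto
  ultimately show ?thesis using finite_subset by blast
qed

text \<open>Change of basis by sqrt 2 = zeta - zeta^3 and sqrt 2 * zeta = 1 + zeta^2.\<close>

lemma emb_zcomb: "emb (Quad a b, Quad c d) = zcomb (of_int (a + d)) (of_int (b + c)) (of_int d) (of_int (- b))"
  unfolding zcomb_Complex emb_def
  by (simp add: zeta8_eq complex_eq_iff val_def real_div_sqrt field_simps of_rat_add of_rat_minus)

lemma cemb_zcomb: "cemb (Quad a b, Quad c d) = zcomb (of_int (a + d)) (of_int (- b)) (of_int (- d)) (of_int (b + c))"
  unfolding zcomb_Complex cemb_def
  by (simp add: zeta8_cube complex_eq_iff cval_def real_div_sqrt field_simps of_rat_add of_rat_minus)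

text \<open>As \<open>sigma8\<close> is a definite description, its values come from the
  homomorphism laws: integers are fixed by induction, and the powers of zeta follow from the
  prescribed value at zeta.\<close>

lemma sigma8_zcomb_int:
  "sigma8 (zcomb (of_int a) (of_int b) (of_int c) (of_int d)) = zcomb (of_int a) (of_int d) (of_int (- c)) (of_int b)"
proof -
  let ?t = sigma8 and ?i = "\<lambda>n::int. zcomb (of_int n) 0 0 0"
  have add: "?t (x + y) = ?t x + ?t y" and mult: "?t (x * y) = ?t x * ?t y"
    if "x \<in> rat_zeta8" "y \<in> rat_zeta8" for x y
    using sigma8(2) that by (auto simp: field_aut_on_def)
  have cl: "x + y \<in> rat_zeta8" "x * y \<in> rat_zeta8" if "x \<in> rat_zeta8" "y \<in> rat_zeta8" for x y
    using that by (auto simp: rat_zeta8_iff[of x] rat_zeta8_iff[of y] zcomb_add zcomb_mult)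
  have z: "zeta8 = zcomb 0 1 0 0" "zeta8 ^ 3 = zcomb 0 0 0 1" "zcomb 0 0 0 0 = 0" "zcomb 1 0 0 0 = 1"
    by (simp_all add: zcomb_def)
  have t0: "?t (?i 0) = ?i 0" using add[OF zcomb_in[of 0 0 0 0] zcomb_in[of 0 0 0 0]] by (simp add: z)
  have inj: "inj_on ?t rat_zeta8" using sigma8(2) by (auto simp: field_aut_on_def bij_betw_def)
  \<comment> \<open>Multiplicativity leaves 0 and 1 as possible images of 1; injectivity excludes
    0.\<close>
  have "?t (zcomb 1 0 0 0) \<noteq> ?t (zcomb 0 0 0 0)"
    using inj_onD[OF inj _ zcomb_in zcomb_in] by (metis z(3,4) zero_neq_one)
  then have t1: "?t (?i 1) = ?i 1"
    using mult[OF zcomb_in[of 1 0 0 0] zcomb_in[of 1 0 0 0]] t0 by (simp add: z)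
  have ti: "?t (?i n) = ?i n" for n
  proof (induction n rule: int_induct[where k = 0])
    case base
    then show ?case by (rule t0)
  next
    case (step1 n)
    have "?t (?i n + ?i 1) = ?t (?i n) + ?t (?i 1)" by (rule add) auto
    then show ?case unfolding step1 t1 by (simp add: zcomb_add)
  next
    case (step2 n)
    have "?t (?i (n - 1) + ?i 1) = ?t (?i (n - 1)) + ?t (?i 1)" by (rule add) auto
    moreover have "?i (n - 1) + ?i 1 = ?i n" by (simp add: zcomb_add)
    ultimately have "?t (?i (n - 1)) = ?i n - ?i 1" using step2 t1 by (simp add: algebra_simps)
    then show ?case by (simp add: zcomb_def of_rat_diff)
  qed
  have tz: "?t (zcomb 0 1 0 0) = zcomb 0 0 0 1" using sigma8(3) unfolding z(2) by (simp add: z(1))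
  have tz2: "?t (zcomb 0 0 1 0) = zcomb 0 0 (- 1) 0"
    using mult[of "zcomb 0 1 0 0" "zcomb 0 1 0 0"] by (simp add: zcomb_mult tz)
  have tz3: "?t (zcomb 0 0 0 1) = zcomb 0 1 0 0"
    using mult[of "zcomb 0 1 0 0" "zcomb 0 0 1 0"] by (simp add: zcomb_mult tz tz2)
  have e: "zcomb (of_int a) (of_int b) (of_int c) (of_int d) =
      ((?i a + ?i b * zcomb 0 1 0 0) + ?i c * zcomb 0 0 1 0) + ?i d * zcomb 0 0 0 1"
    by (simp add: zcomb_mult zcomb_add)
  have "?t (((?i a + ?i b * zcomb 0 1 0 0) + ?i c * zcomb 0 0 1 0) + ?i d * zcomb 0 0 0 1) =
      ((?t (?i a) + ?t (?i b) * ?t (zcomb 0 1 0 0)) + ?t (?i c) * ?t (zcomb 0 0 1 0)) + ?t (?i d) * ?t (zcomb 0 0 0 1)"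
    by (simp only: add mult cl zcomb_in)
  also have "\<dots> = zcomb (of_int a) (of_int d) (of_int (- c)) (of_int b)"
    by (simp add: ti tz tz2 tz3 zcomb_mult zcomb_add)
  finally show ?thesis unfolding e .
qed

lemma sigma8_emb: "sigma8 (emb p) = cemb p"
proof -
  obtain a b c d where p: "p = (Quad a b, Quad c d)" by (metis prod.exhaust quad.exhaust)
  show ?thesis unfolding p emb_zcomb sigma8_zcomb_int cemb_zcomb by simp
qed

lemma int_zeta8_eq: "int_zeta8 = range emb"
proof
  show "int_zeta8 \<subseteq> range emb"
  proof
    fix x assume "x \<in> int_zeta8"
    then obtain c :: "nat \<Rightarrow> int" where x: "x = (\<Sum>k<4. of_int (c k) * zeta8 ^ k)"
      by (auto simp: int_zeta8_def)
    have "x = emb (Quad (c 0 - c 2) (- c 3), Quad (c 1 + c 3) (c 2))"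
      unfolding emb_zcomb x by (simp add: zcomb_def eval_nat_numeral)
    then show "x \<in> range emb" by blast
  qed
  show "range emb \<subseteq> int_zeta8"
  proof
    fix x assume "x \<in> range emb"
    then obtain a b c d where "x = emb (Quad a b, Quad c d)" by (metis imageE prod.exhaust quad.exhaust)
    then have "x = (\<Sum>k<4. of_int ((\<lambda>k::nat. [a + d, b + c, d, - b] ! k) k) * zeta8 ^ k)"
      unfolding emb_zcomb by (simp add: zcomb_def eval_nat_numeral of_rat_add of_rat_minus)
    then show "x \<in> int_zeta8" unfolding int_zeta8_def by blast
  qed
qed

lemma A_set_eq: "A_set W = emb ` {p. cemb p \<in> W}"
  unfolding A_set_def int_zeta8_eq by (auto simp: sigma8_emb)

lemma emb_in_A_set_iff: "emb p \<in> A_set W \<longleftrightarrow> cemb p \<in> W"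
  unfolding A_set_eq by (auto simp: emb_inject)

lemma finite_A_set_ball:
  assumes "bounded W"
  shows "finite {x \<in> A_set W. norm x < T}"
proof -
  obtain H where "\<And>w. w \<in> W \<Longrightarrow> norm w \<le> H" using assms by (auto simp: bounded_iff)
  then have "{x \<in> A_set W. norm x < T} \<subseteq> emb ` {p. norm (emb p) \<le> T \<and> norm (cemb p) \<le> H}"
    by (auto simp: A_set_eq)
  then show ?thesis using finite_emb_cemb_bounded finite_subset by blast
qed

section \<open>Triangle areas\<close>

text \<open>Transfers areas from \<open>real^2\<close>, where \<open>content_triangle\<close> is
  stated, to \<open>complex\<close>; it suffices to compare boxes.\<close>

lemma lborel_complex_eq: "(lborel :: complex measure) = distr lborel borel (\<lambda>v::real^2. Complex (v $ 1) (v $ 2))"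
proof (rule lborel_eqI)
  let ?g = "\<lambda>v::real^2. Complex (v $ 1) (v $ 2)"
  have g: "?g \<in> borel_measurable borel"
    by (intro borel_measurable_continuous_onI continuous_intros)
  fix l u :: complex assume le: "\<And>b. b \<in> Basis \<Longrightarrow> l \<bullet> b \<le> u \<bullet> b"
  have le': "Re l \<le> Re u" "Im l \<le> Im u" using le[of 1] le[of \<i>] by (simp_all add: Basis_complex_def)
  let ?f = "\<lambda>z. vector [Re z, Im z] :: real^2"
  have v: "?g -` box l u = box (?f l) (?f u)"
    by (auto simp: box_complex_eq mem_box_cart forall_2 in_box_complex_iff)
  have fle: "?f l $ i \<le> ?f u $ i" for i
    using exhaust_2[of i] le' by auto
  have "emeasure (distr lborel borel ?g) (box l u) = emeasure lborel (box (?f l) (?f u))"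
    using g by (subst emeasure_distr) (simp_all add: v)
  also have "\<dots> = (\<Prod>b\<in>Basis. (?f u - ?f l) \<bullet> b)"
    using fle by (intro emeasure_lborel_box) (auto simp: Basis_vec_def inner_axis)
  also have "(\<Prod>b\<in>Basis. (?f u - ?f l) \<bullet> b) = (Re u - Re l) * (Im u - Im l)"
  proof -
    have B: "(Basis :: (real^2) set) = {axis 1 1, axis 2 1}" by (auto simp: Basis_vec_def UNIV_2)
    have "axis 1 1 \<noteq> (axis 2 1 :: real^2)" by (simp add: axis_eq_axis)
    then show ?thesis unfolding B by (simp add: inner_axis)
  qed
  also have "\<dots> = (\<Prod>b\<in>Basis. (u - l) \<bullet> b)" by (simp add: Basis_complex_def)
  finally show "emeasure (distr lborel borel ?g) (box l u) = (\<Prod>b\<in>Basis. (u - l) \<bullet> b)" .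
qed simp

lemma tri_area_eq: "tri_area x y = \<bar>Im (cnj x * y)\<bar> / 2"
proof -
  let ?g = "\<lambda>v::real^2. Complex (v $ 1) (v $ 2)" and ?f = "\<lambda>z. vector [Re z, Im z] :: real^2"
  have g: "?g \<in> borel_measurable borel"
    by (intro borel_measurable_continuous_onI continuous_intros)
  have lin: "linear ?g"
    by (rule linearI) (simp_all add: complex_eq_iff)
  have gf: "?g (?f z) = z" "?f (?g v) = v" for z v
    by (simp_all add: vec_eq_iff forall_2)
  let ?H = "convex hull {0, x, y}" and ?K = "convex hull {0, ?f x, ?f y}"
  have "?g ` ?K = convex hull (?g ` {0, ?f x, ?f y})" by (rule convex_hull_linear_image[OF lin])
  also have "?g ` {0, ?f x, ?f y} = {0, x, y}" using gf by (simp add: zero_complex.code)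
  finally have "?g -` ?H = ?K" using gf by (metis (no_types, lifting) inj_on_def inj_vimage_image_eq)
  moreover have cl: "?H \<in> sets borel"
    by (intro borel_closed compact_imp_closed finite_imp_compact_convex_hull) auto
  ultimately have "measure lborel ?H = measure lborel ?K"
    using g by (subst lborel_complex_eq) (simp add: measure_distr)
  also have "\<dots> = \<bar>Im (cnj x * y)\<bar> / 2"
    by (subst content_triangle) (simp add: algebra_simps abs_minus_commute)
  finally show ?thesis unfolding tri_area_def using cl by (simp add: measure_completion)
qed

section \<open>The lower bound for determinants\<close>

lemma tri_area_le_max:
  assumes "bounded W" "x \<in> W" "y \<in> W"
  shows "tri_area x y \<le> max_tri_area W"
proof -
  obtain B where B: "\<And>w. w \<in> W \<Longrightarrow> norm w \<le> B" using assms by (auto simp: bounded_iff)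
  have "tri_area u v \<le> B * B" if "u \<in> W" "v \<in> W" for u v
  proof -
    have "tri_area u v \<le> norm (cnj u * v)"
      unfolding tri_area_eq using abs_Im_le_cmod[of "cnj u * v"] norm_ge_zero[of "cnj u * v"] by linarith
    also have "\<dots> \<le> B * B" unfolding norm_mult complex_mod_cnj
      using B[OF that(1)] B[OF that(2)] order_trans[OF norm_ge_zero B[OF that(1)]]
      by (intro mult_mono) auto
    finally show ?thesis .
  qed
  then have "bdd_above ((\<lambda>(x, y). tri_area x y) ` (W \<times> W))" by (intro bdd_aboveI[of _ "B * B"]) auto
  from cSUP_upper[OF _ this, of "(x, y)"] show ?thesis using assms by (simp add: max_tri_area_def)
qed

lemma open_stretch:
  assumes "open W" "x \<in> (W :: complex set)"
  obtains t where "t > 1" "of_real t * x \<in> W"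
proof -
  have "((\<lambda>t. of_real t * x) \<longlongrightarrow> of_real 1 * x) (at_right 1)" by (intro tendsto_intros)
  then have "eventually (\<lambda>t. of_real t * x \<in> W) (at_right 1)"
    using assms by (intro topological_tendstoD) auto
  then obtain b where b: "b > 1" "\<And>t. 1 < t \<Longrightarrow> t < b \<Longrightarrow> of_real t * x \<in> W"
    unfolding eventually_at_right_field by blast
  have "1 < (1 + b) / 2" "(1 + b) / 2 < b" using b(1) by simp_all
  then show ?thesis using that b(2) by blast
qed

lemma max_tri_area_pos:
  assumes "open W" "bounded W" "0 \<in> W"
  shows "max_tri_area W > 0"
proof -
  obtain e where e: "e > 0" "ball 0 e \<subseteq> W" using assms open_contains_ball by blast
  define x where "x = complex_of_real (e / 2)"
  have "x \<in> W" "\<i> * x \<in> W" using e by (auto simp: x_def norm_mult subset_iff)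
  then have "tri_area x (\<i> * x) \<le> max_tri_area W" using assms by (intro tri_area_le_max)
  moreover have "tri_area x (\<i> * x) > 0" using e by (simp add: tri_area_eq x_def)
  ultimately show ?thesis by linarith
qed

text \<open>Openness allows x to be pushed outwards inside W, which enlarges the area, so the
  supremum is not attained. This yields the strict inequality that \<open>quad_small_eq_0\<close>
  asks for.\<close>

lemma tri_area_less_max:
  assumes "open W" "bounded W" "0 \<in> W" "x \<in> W" "y \<in> W"
  shows "tri_area x y < max_tri_area W"
proof (cases "tri_area x y = 0")
  case True
  then show ?thesis using max_tri_area_pos assms by simp
next
  case False
  then have pos: "tri_area x y > 0" by (simp add: tri_area_eq)
  obtain t where t: "t > 1" "of_real t * x \<in> W" using open_stretch assms by blast
  have "tri_area x y < t * tri_area x y" using t pos by simp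
  also have "\<dots> = tri_area (of_real t * x) y"
  proof -
    have "Im (cnj (of_real t * x) * y) = t * Im (cnj x * y)" by (simp add: algebra_simps)
    then show ?thesis unfolding tri_area_eq using t by (simp add: abs_mult)
  qed
  also have "\<dots> \<le> max_tri_area W" using t assms by (intro tri_area_le_max)
  finally show ?thesis .
qed

lemma greatest_lam_powi:
  assumes "C > 0" "m = (GREATEST k::int. lam powi k < C)"
  shows "lam powi m < C" "C \<le> lam powi (m + 1)"
proof -
  obtain k where k: "lam powi k \<le> C" "C < lam powi (k + 1)" using lam_powi_bracket[OF assms(1)] .
  \<comment> \<open>The bracket is closed on the left whereas the maximal exponent needs a strict
    inequality, so equality costs one step down.\<close>
  define j where "j = (if lam powi k = C then k - 1 else k)"
  have j: "lam powi j < C" "C \<le> lam powi (j + 1)"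
    using k power_int_strict_increasing[of "k - 1" k lam] lam_gt_1 by (auto simp: j_def)
  have "(GREATEST k::int. lam powi k < C) = j"
  proof (rule Greatest_equality)
    fix i assume i: "lam powi i < C"
    show "i \<le> j"
    proof (rule ccontr)
      assume "\<not> i \<le> j"
      then have "lam powi (j + 1) \<le> lam powi i" using lam_gt_1 by (intro power_int_increasing) auto
      then show False using i j by linarith
    qed
  qed (rule j)
  then show "lam powi m < C" "C \<le> lam powi (m + 1)" using j assms by auto
qed

lemma abs_cval_qdet: "\<bar>cval (qdet p q)\<bar> = 2 * sqrt 2 * tri_area (cemb p) (cemb q)"
  unfolding tri_area_eq Im_cemb by (simp add: field_simps)

lemma abs_val_qdet_ge:
  assumes W: "open W" "bounded W" "0 \<in> W"
    and m: "2 * sqrt 2 * max_tri_area W \<le> lam powi (m + 1)"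
    and p: "cemb p \<in> W" "cemb q \<in> W" and nz: "qdet p q \<noteq> 0"
  shows "\<bar>val (qdet p q)\<bar> \<ge> lam powi (- m)"
proof (rule ccontr)
  assume small: "\<not> ?thesis"
  have lm: "lam powi m > 0" using lam_pos by simp
  have lm1: "lam powi (m + 1) = lam powi m * lam" using lam_pos by (simp add: power_int_add)
  define v where "v = qdet p q * lam_unit m"
  have "2 * sqrt 2 * tri_area (cemb p) (cemb q) < 2 * sqrt 2 * max_tri_area W"
    using tri_area_less_max[OF W p] by (intro mult_strict_left_mono) auto
  then have "\<bar>cval (qdet p q)\<bar> < lam powi m * lam"
    using m lm1 unfolding abs_cval_qdet by linarith
  then have "\<bar>cval v\<bar> < lam"
    using lm abs_cval_lam_unit[of m] by (simp add: v_def abs_mult power_int_minus field_simps)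
  moreover have "\<bar>val v\<bar> < 1"
    using small lm by (simp add: v_def abs_mult val_lam_unit power_int_minus field_simps)
  ultimately have "v = 0" by (intro quad_small_eq_0)
  then have "v * lam_unit (- m) = 0" by simp
  then have "qdet p q * (lam_unit m * lam_unit (- m)) = 0" by (simp only: v_def mult.assoc)
  then show False using nz by (simp add: lam_unit_mult)
qed

lemma Im_A_set_ge:
  assumes W: "open W" "bounded W" "0 \<in> W"
    and m: "2 * sqrt 2 * max_tri_area W \<le> lam powi (m + 1)"
    and xy: "x \<in> A_set W" "y \<in> A_set W" "Im (cnj x * y) \<noteq> 0"
  shows "\<bar>Im (cnj x * y)\<bar> \<ge> lam powi (- m) / sqrt 2"
proof -
  obtain p q where pq: "x = emb p" "y = emb q" "cemb p \<in> W" "cemb q \<in> W"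
    using xy by (auto simp: A_set_eq)
  have "qdet p q \<noteq> 0" using xy(3) unfolding pq Im_emb by auto
  from abs_val_qdet_ge[OF W m pq(3,4) this] show ?thesis unfolding pq Im_emb
    by (simp add: divide_right_mono)
qed

section \<open>Many pairs of points with minimal determinant\<close>

text \<open>Relative to Z, the imaginary coordinate of X is determined by the determinant and |Z|.
  Once the determinant is fixed, only the real coordinate is free.\<close>

lemma complex_polar_decomposition:
  assumes "Z \<noteq> 0"
  shows "X = Complex (Re (X / Z)) (- Im (cnj X * Z) / (norm Z)\<^sup>2) * Z"
proof -
  have "X / Z = X * cnj Z / of_real ((norm Z)\<^sup>2)"
    by (rule complex_div_cnj)
  then have "Im (X / Z) = Im (X * cnj Z) / (norm Z)\<^sup>2" by (simp only: Im_divide_of_real)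
  also have "Im (X * cnj Z) = - Im (cnj X * Z)" by (simp add: algebra_simps)
  finally have "X / Z = Complex (Re (X / Z)) (- Im (cnj X * Z) / (norm Z)\<^sup>2)"
    by (simp only: complex_eq_iff complex.sel)
  then show ?thesis using assms by (metis nonzero_divide_eq_eq)
qed

lemma qdet_add_left: "qdet (p + q) z = qdet p z + qdet q z"
  and qdet_diff_right: "qdet z (p - q) = qdet z p - qdet z q"
  and qdet_qscale_left: "qdet (qscale s p) z = s * qdet p z"
  and qdet_self: "qdet z z = 0"
  and qdet_swap: "qdet p q = - qdet q p"
  by (simp_all add: qdet_def qscale_def algebra_simps)

text \<open>Taking determinants with z recovers the real ratio t as an element of the ring, because
  \<open>qdet x z\<close> is a unit. The proportionality therefore passes to the conjugates.\<close>

lemma real_multiple_of_primitive: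
  assumes "emb y = of_real t * emb x" "v * qdet x z = 1"
  shows "val (v * qdet y z) = t" "y = qscale (v * qdet y z) x"
proof -
  have "val (qdet y z) / sqrt 2 = Im (of_real t * (cnj (emb x) * emb z))"
    unfolding Im_emb[symmetric] assms by (simp add: mult_ac)
  also have "\<dots> = t * (val (qdet x z) / sqrt 2)" unfolding Im_emb[symmetric] by simp
  finally have "val (qdet y z) = t * val (qdet x z)" by simp
  then have "val (v * qdet y z) = t * val (v * qdet x z)" by simp
  then show v: "val (v * qdet y z) = t" using assms(2) by simp
  have "emb y = emb (qscale (v * qdet y z) x)" unfolding emb_qscale v by (rule assms)
  then show "y = qscale (v * qdet y z) x" by (simp only: emb_inject)
qed

text \<open>By convexity, shrinking one vector towards the origin stays in W and scales the
  determinant down to the required size; exchanging the vectors corrects its sign.\<close>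

lemma prescribed_determinant:
  assumes W: "convex W" "0 \<in> W" and D: "\<bar>D\<bar> < 2 * max_tri_area W" "D \<noteq> 0"
  obtains w1 w2 where "w1 \<in> W" "w2 \<in> W" "Im (cnj w1 * w2) = D"
proof -
  have "\<bar>D\<bar> / 2 < (SUP (x, y) \<in> W \<times> W. tri_area x y)" using D by (simp add: max_tri_area_def)
  then obtain a b where ab: "a \<in> W" "b \<in> W" "\<bar>D\<bar> / 2 < tri_area a b"
  proof -
    have "(\<lambda>(x, y). tri_area x y) ` (W \<times> W) \<noteq> {}" using W by auto
    then obtain c where "c \<in> (\<lambda>(x, y). tri_area x y) ` (W \<times> W)" "\<bar>D\<bar> / 2 < c"
      using less_cSupD[OF _ \<open>\<bar>D\<bar> / 2 < _\<close>] by blast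
    then show ?thesis using that by auto
  qed
  define J where "J = Im (cnj a * b)"
  define t where "t = \<bar>D\<bar> / \<bar>J\<bar>"
  have J: "\<bar>J\<bar> > \<bar>D\<bar>" using ab(3) by (simp add: tri_area_eq J_def)
  have t: "0 \<le> t" "t \<le> 1" using J by (auto simp: t_def divide_le_eq)
  have "t *\<^sub>R a + (1 - t) *\<^sub>R 0 \<in> W" using t by (intro convexD W ab) auto
  then have ta: "of_real t * a \<in> W" by (simp add: scaleR_conv_of_real)
  have "Im (cnj (of_real t * a) * b) = t * J" by (simp add: J_def algebra_simps)
  then have "\<bar>Im (cnj (of_real t * a) * b)\<bar> = t * \<bar>J\<bar>" by (simp only: abs_mult abs_of_nonneg[OF t(1)])
  then have "\<bar>Im (cnj (of_real t * a) * b)\<bar> = \<bar>D\<bar>" using J by (simp add: t_def)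
  moreover have "Im (cnj b * (of_real t * a)) = - Im (cnj (of_real t * a) * b)"
    by (simp add: algebra_simps)
  ultimately have "Im (cnj (of_real t * a) * b) = D \<or> Im (cnj b * (of_real t * a)) = D" by linarith
  then show ?thesis using that ta ab by blast
qed

text \<open>With the determinant fixed at D, w is a continuous function of its real coordinate
  \<tau> and of v. For the later x and z the conjugate determinant is exactly D, so controlling
  these two data keeps \<open>cemb x\<close> near w.\<close>

lemma stable_neighbourhood:
  fixes w v :: complex
  assumes "v \<noteq> 0" "open U" "w \<in> U" and "w = Complex \<tau> (- D / (norm v)\<^sup>2) * v"
  obtains d where "d > 0"
    "\<And>\<tau>' z. \<bar>\<tau>' - \<tau>\<bar> < d \<Longrightarrow> norm (z - v) < d \<Longrightarrow> Complex \<tau>' (- D / (norm z)\<^sup>2) * z \<in> U"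
proof -
  let ?f = "\<lambda>p :: real \<times> complex. Complex (fst p) (- D / (norm (snd p))\<^sup>2) * snd p"
  have "isCont ?f (\<tau>, v)" unfolding Complex_eq
    using assms(1) by (intro continuous_intros) auto
  then have "(?f \<longlongrightarrow> ?f (\<tau>, v)) (nhds (\<tau>, v))"
    using tendsto_at_iff_tendsto_nhds[of ?f "(\<tau>, v)"] by (simp only: isCont_def)
  then have "(?f \<longlongrightarrow> w) (nhds (\<tau>, v))" unfolding assms(4) by simp
  then have "eventually (\<lambda>p. ?f p \<in> U) (nhds (\<tau>, v))" using assms by (intro topological_tendstoD)
  then obtain d where d: "d > 0" "\<And>p. dist p (\<tau>, v) < d \<Longrightarrow> ?f p \<in> U"
    unfolding eventually_nhds_metric by blast
  have "Complex \<tau>' (- D / (norm z)\<^sup>2) * z \<in> U" if "\<bar>\<tau>' - \<tau>\<bar> < d / 2" "norm (z - v) < d / 2" for \<tau>' z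
  proof -
    have "dist (\<tau>', z) (\<tau>, v) \<le> dist \<tau>' \<tau> + dist z v"
      unfolding dist_Pair_Pair by (rule sqrt_sum_squares_le_sum) auto
    also have "\<dots> < d" using that by (simp add: dist_norm)
    finally show ?thesis using d(2)[of "(\<tau>', z)"] by simp
  qed
  then show ?thesis using that[of "d / 2"] d by simp
qed

text \<open>For a primitive \<open>z\<close>, the vectors \<open>x\<close> with \<open>qdet x z\<close> prescribed form a coset \<open>q0 + \<int>[\<surd>2] z\<close>.
  When \<open>z\<close> is short compared to \<open>T\<close>, the window available for the multiplier is long enough for
  the coset to contain a point of the required kind.\<close>

lemma partner_exists:
  assumes z: "primitive z" "norm (emb z) \<le> e / L * T" "norm (emb z) \<le> e / 2 * T"
    and e: "0 < e" "e < 1 / 2" and T: "T > 0" "norm (emb z) \<ge> z0" "z0 > 0" "D0 / z0 < e / 2 * T"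
    and L: "L > 0" "\<And>x y. \<exists>q. x \<le> val q \<and> val q \<le> x + L \<and> y \<le> cval q \<and> cval q \<le> y + r"
    and u: "val u = sqrt 2 * D0" "cval u = sqrt 2 * D" "D0 > 0"
  obtains x \<tau>' where "qdet x z = u" "\<tau> \<le> \<tau>'" "\<tau>' \<le> \<tau> + r"
    "cemb x = Complex \<tau>' (- D / (norm (cemb z))\<^sup>2) * cemb z"
    "norm (emb x) < T" "norm (emb x + emb z) < T" "norm (emb x) \<ge> (1 - 2 * e) * T"
    "Re (cnj (emb x) * (emb x + emb z)) \<ge> (1 - 2 * e)\<^sup>2 * T\<^sup>2"
proof -
  define Z where "Z = emb z"
  have Z: "norm Z > 0" "Z \<noteq> 0" "z \<noteq> 0" using T by (auto simp: Z_def emb_eq_0_iff[symmetric])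
  have cz: "cemb z \<noteq> 0" using norm_emb_cemb_ge[OF Z(3)] by auto
  obtain p where p: "qdet z p = 1" using z by (auto simp: primitive_def)
  \<comment> \<open>The sign compensates for \<open>qdet p z = - qdet z p = -1\<close>.\<close>
  define q0 where "q0 = qscale (- u) p"
  have q0: "qdet q0 z = u" using p by (simp add: q0_def qdet_qscale_left qdet_swap[of p])
  define \<rho> where "\<rho> = Re (emb q0 / Z)"
  define \<rho>' where "\<rho>' = Re (cemb q0 / cemb z)"
  \<comment> \<open>The value of s places x at distance between (1 - 2 e) T and (1 - e) T along Z;
    its conjugate independently places the real coordinate of \<open>cemb x\<close> just above
    \<tau>.\<close>
  obtain s where s: "(1 - 2 * e) * T / norm Z - \<rho> \<le> val s" "val s \<le> (1 - 2 * e) * T / norm Z - \<rho> + L"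
    "\<tau> - \<rho>' \<le> cval s" "cval s \<le> \<tau> - \<rho>' + r"
    using L(2) by blast
  define x where "x = q0 + qscale s z"
  have qx: "qdet x z = u" by (simp add: x_def qdet_add_left qdet_qscale_left qdet_self q0)
  define \<sigma> where "\<sigma> = \<rho> + val s"
  define \<kappa> where "\<kappa> = - D0 / (norm Z)\<^sup>2"
  have X: "emb x = Complex \<sigma> \<kappa> * Z"
  proof -
    have "emb x / Z = emb q0 / Z + of_real (val s)"
      unfolding x_def emb_add emb_qscale using Z by (simp add: add_divide_distrib flip: Z_def)
    then have "Re (emb x / Z) = \<sigma>" by (simp add: \<sigma>_def \<rho>_def)
    moreover have "Im (cnj (emb x) * Z) = D0" unfolding Z_def Im_emb qx using u by simp
    ultimately show ?thesis using complex_polar_decomposition[OF Z(2), of "emb x"] by (simp add: \<kappa>_def)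
  qed
  have cX: "cemb x = Complex (\<rho>' + cval s) (- D / (norm (cemb z))\<^sup>2) * cemb z"
  proof -
    have "cemb x / cemb z = cemb q0 / cemb z + of_real (cval s)"
      unfolding x_def cemb_add cemb_qscale using cz by (simp add: add_divide_distrib)
    then have "Re (cemb x / cemb z) = \<rho>' + cval s" by (simp add: \<rho>'_def)
    moreover have "Im (cnj (cemb x) * cemb z) = D" unfolding Im_cemb qx using u by simp
    ultimately show ?thesis using complex_polar_decomposition[OF cz, of "cemb x"] by simp
  qed
  have "(1 - 2 * e) * T / norm Z \<le> \<sigma>" "\<sigma> \<le> (1 - 2 * e) * T / norm Z + L" using s by (simp_all add: \<sigma>_def)
  then have "(1 - 2 * e) * T \<le> \<sigma> * norm Z" "\<sigma> * norm Z \<le> (1 - 2 * e) * T + L * norm Z"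
    using Z(1) mult_right_mono[of \<sigma> "(1 - 2 * e) * T / norm Z + L" "norm Z"]
    by (simp_all add: pos_divide_le_eq distrib_right)
  moreover have "L * norm Z \<le> e * T" using z(2) L(1) by (simp add: Z_def field_simps)
  ultimately have \<sigma>: "(1 - 2 * e) * T \<le> \<sigma> * norm Z" "\<sigma> * norm Z \<le> (1 - e) * T"
    by (simp_all add: algebra_simps)
  have \<sigma>0: "\<sigma> > 0"
  proof -
    have "0 < (1 - 2 * e) * T" using e T by simp
    then have "0 < \<sigma> * norm Z" using \<sigma> by linarith
    then show ?thesis using Z(1) by (simp add: zero_less_mult_iff)
  qed
  \<comment> \<open>The component of x orthogonal to Z has length D0 / |Z|, which is small compared
    to T since z is not too short.\<close>
  have "D0 / norm Z \<le> D0 / z0" using T u Z(1) by (intro divide_left_mono mult_pos_pos) (auto simp: Z_def)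
  then have "D0 / norm Z < e / 2 * T" using T by linarith
  moreover have "\<bar>\<kappa>\<bar> * norm Z = D0 / norm Z" using u Z(1) by (simp add: \<kappa>_def power2_eq_square)
  ultimately have \<kappa>: "\<bar>\<kappa>\<bar> * norm Z < e / 2 * T" by simp
  have nle: "norm (Complex a b * Z) \<le> (\<bar>a\<bar> + \<bar>b\<bar>) * norm Z" "norm (Complex a b * Z) \<ge> \<bar>a\<bar> * norm Z" for a b
    unfolding norm_mult using cmod_le[of "Complex a b"] abs_Re_le_cmod[of "Complex a b"]
    by (simp_all add: mult_right_mono)
  have n1: "norm (emb x) < T"
  proof -
    have "norm (emb x) \<le> \<sigma> * norm Z + \<bar>\<kappa>\<bar> * norm Z"
      unfolding X using nle(1)[of \<sigma> \<kappa>] \<sigma>0 by (simp add: distrib_right)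
    also have "\<dots> < (1 - e) * T + e / 2 * T" using \<sigma> \<kappa> by linarith
    also have "\<dots> \<le> T" using e T by (simp add: algebra_simps)
    finally show ?thesis .
  qed
  have n2: "norm (emb x + Z) < T"
  proof -
    have "emb x + Z = Complex (\<sigma> + 1) \<kappa> * Z" unfolding X by (simp add: complex_eq_iff algebra_simps)
    then have "norm (emb x + Z) \<le> \<sigma> * norm Z + norm Z + \<bar>\<kappa>\<bar> * norm Z"
      using nle(1)[of "\<sigma> + 1" \<kappa>] \<sigma>0 by (simp add: distrib_right)
    also have "\<dots> < (1 - e) * T + e / 2 * T + e / 2 * T" using \<sigma> \<kappa> z(3) unfolding Z_def by linarith
    also have "\<dots> = T" by (simp add: algebra_simps)
    finally show ?thesis .
  qed
  have n3: "norm (emb x) \<ge> (1 - 2 * e) * T"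
    unfolding X using nle(2)[of \<sigma> \<kappa>] \<sigma> \<sigma>0 by simp
  \<comment> \<open>The orthogonal component does not contribute to the extra term, which is
    nonnegative because \<sigma> > 0; so |x|^2 is a lower bound.\<close>
  have "Re (cnj (emb x) * (emb x + Z)) = (norm (emb x))\<^sup>2 + \<sigma> * (norm Z)\<^sup>2"
    unfolding X by (simp add: cmod_power2 norm_mult power_mult_distrib) (simp add: algebra_simps power2_eq_square)
  moreover have "((1 - 2 * e) * T)\<^sup>2 \<le> (norm (emb x))\<^sup>2" using n3 e T by (intro power_mono) auto
  moreover have "\<sigma> * (norm Z)\<^sup>2 \<ge> 0" using \<sigma>0 by simp
  ultimately have n4: "Re (cnj (emb x) * (emb x + Z)) \<ge> (1 - 2 * e)\<^sup>2 * T\<^sup>2" by (simp add: power_mult_distrib)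
  show ?thesis
    by (rule that[of x "\<rho>' + cval s"]) (use s qx cX n1 n2 n3 n4 in \<open>simp_all flip: Z_def\<close>)
qed

text \<open>Equal arguments make x' = s x with s in the ring. Both points are close to length T and
  both conjugates close to w, so s - 1 is below 1 in both embeddings and vanishes. Then z' - z has
  determinant 0 with x, hence is k x with k in the ring, and k vanishes in the same way.\<close>

lemma partner_unique:
  assumes "qdet x z = u" "qdet x' z' = u" "u * v = 1"
    and Arg: "Arg (emb x) = Arg (emb x')"
    and X: "norm (emb x) \<in> {9/10 * T..<T}" "norm (emb x') \<in> {9/10 * T..<T}" "T > 0"
    and cX: "norm (cemb x - w) < norm w / 10" "norm (cemb x' - w) < norm w / 10"
    and Z: "norm (emb z) \<le> T / 20" "norm (emb z') \<le> T / 20"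
    and cZ: "norm (cemb z - b) < norm w / 10" "norm (cemb z' - b) < norm w / 10"
  shows "z = z'"
proof -
  have vu: "v * qdet x z = 1" using assms by (simp add: mult.commute)
  have X1: "9/10 * T \<le> norm (emb x)" "norm (emb x) < T" "9/10 * T \<le> norm (emb x')" "norm (emb x') < T"
    using X by auto
  then have X0: "norm (emb x) > 0" using X(3) by linarith
  have cx: "norm (cemb x) \<ge> 9/10 * norm w"
    using cX(1) norm_triangle_ineq2[of w "w - cemb x"] by (simp add: norm_minus_commute)
  have w: "norm w > 0" using le_less_trans[OF norm_ge_zero cX(1)] by simp
  define t where "t = norm (emb x') / norm (emb x)"
  have "emb x' = of_real (norm (emb x')) * cis (Arg (emb x'))" by (simp add: rcis_cmod_Arg flip: rcis_def)
  moreover have "emb x = of_real (norm (emb x)) * cis (Arg (emb x))" by (simp add: rcis_cmod_Arg flip: rcis_def)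
  ultimately have "emb x' * of_real (norm (emb x)) = of_real (norm (emb x')) * emb x"
    using Arg by (metis mult.assoc mult.commute)
  then have e: "emb x' = of_real t * emb x" using X0 by (simp add: t_def field_simps)
  define s where "s = v * qdet x' z"
  have s: "val s = t" "x' = qscale s x"
    using real_multiple_of_primitive[OF e vu] by (simp_all add: s_def)
  have "s - 1 = 0"
  proof (rule quad_eq_0)
    have "\<bar>t - 1\<bar> * norm (emb x) = \<bar>norm (emb x') - norm (emb x)\<bar>"
      using X0 by (simp add: t_def field_simps abs_mult flip: abs_mult_pos)
    also have "\<dots> < 9/10 * T" using X1 X(3) by linarith
    also have "\<dots> \<le> 1 * norm (emb x)" using X by simp
    finally have 1: "\<bar>val (s - 1)\<bar> < 1" using X0 by (simp add: s)
    have "\<bar>cval (s - 1)\<bar> * (9/10 * norm w) \<le> \<bar>cval (s - 1)\<bar> * norm (cemb x)" using cx by (intro mult_left_mono) auto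
    also have "\<dots> = norm (cemb x' - cemb x)"
    proof -
      have "cemb x' - cemb x = of_real (cval (s - 1)) * cemb x"
        by (subst s(2)) (simp add: cemb_qscale algebra_simps)
      then show ?thesis by (simp only: norm_mult norm_of_real)
    qed
    also have "\<dots> < 9/10 * norm w"
      using norm_triangle_ineq4[of "cemb x' - w" "cemb x - w"] cX w
      by (simp only: diff_diff_eq2 diff_add_cancel)
    finally have 2: "\<bar>cval (s - 1)\<bar> < 1" using w by simp
    show "\<bar>val (s - 1)\<bar> * \<bar>cval (s - 1)\<bar> < 1" using 1 2 mult_strict_mono'[of "\<bar>val (s - 1)\<bar>" 1 "\<bar>cval (s - 1)\<bar>" 1] by simp
  qed
  then have xx: "x' = x" using s(2) by (simp add: qscale_def)
  define d where "d = z' - z"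
  have "qdet x d = 0" using assms(1,2) by (simp add: d_def qdet_diff_right xx)
  then have "qdet d x = 0" using qdet_swap[of d x] by simp
  then have I: "Im (cnj (emb d) * emb x) = 0" unfolding Im_emb by simp
  then have ed: "emb d = of_real (Re (emb d / emb x)) * emb x"
    using complex_polar_decomposition[of "emb x" "emb d"] X0 unfolding I by (simp add: complex_of_real_def)
  define k where "k = v * qdet d z"
  have k: "emb d = of_real (val k) * emb x" "d = qscale k x"
    using real_multiple_of_primitive[OF ed vu] ed by (simp_all add: k_def)
  have "k = 0"
  proof (rule quad_eq_0)
    have "\<bar>val k\<bar> * norm (emb x) = norm (emb d)" by (simp add: k(1) norm_mult)
    also have "\<dots> \<le> T / 10" unfolding d_def emb_diff
      using norm_triangle_ineq4[of "emb z'" "emb z"] Z by linarith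
    also have "\<dots> < 1 * norm (emb x)" using X1 X(3) by linarith
    finally have 1: "\<bar>val k\<bar> < 1" using X0 by (simp add: mult_less_cancel_right)
    have "\<bar>cval k\<bar> * (9/10 * norm w) \<le> \<bar>cval k\<bar> * norm (cemb x)" using cx by (intro mult_left_mono) auto
    also have "\<dots> = norm (cemb d)" by (subst k(2)) (simp add: cemb_qscale norm_mult)
    also have "\<dots> < 9/10 * norm w" unfolding d_def cemb_diff
      using norm_triangle_ineq4[of "cemb z' - b" "cemb z - b"] cZ w
      by (simp only: diff_diff_eq2 diff_add_cancel)
    finally have 2: "\<bar>cval k\<bar> < 1" using w by simp
    show "\<bar>val k\<bar> * \<bar>cval k\<bar> < 1" using 1 2 mult_strict_mono'[of "\<bar>val k\<bar>" 1 "\<bar>cval k\<bar>" 1] by simp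
  qed
  then have "d = 0" using k(2) by (simp add: qscale_def zero_prod_def)
  then show ?thesis by (simp add: d_def)
qed

lemma many_close_pairs:
  fixes W :: "complex set"
  assumes W: "open W" "convex W" "bounded W" "0 \<in> W"
    and m: "lam powi m < 2 * sqrt 2 * max_tri_area W"
    and \<epsilon>: "0 < \<epsilon>" "\<epsilon> \<le> 1 / 5"
  obtains c T0 where "c > 0"
    "\<And>T. T \<ge> T0 \<Longrightarrow> \<exists>X \<subseteq> A_set W. c * T\<^sup>2 \<le> real (card X) \<and> inj_on Arg X \<and>
      (\<forall>x\<in>X. x \<noteq> 0 \<and> norm x < T \<and> (\<exists>y\<in>A_set W. norm y < T \<and>
        Im (cnj x * y) = lam powi (- m) / sqrt 2 \<and> (1 - \<epsilon>) * T\<^sup>2 \<le> Re (cnj x * y)))"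
proof -
  \<comment> \<open>A unit whose value gives the least determinant; its conjugate is \<plusminus>
    \<lambda>^m, which still fits into W.\<close>
  define u where "u = lam_unit (- m)"
  define D0 where "D0 = lam powi (- m) / sqrt 2"
  define D where "D = cval u / sqrt 2"
  have u: "val u = sqrt 2 * D0" "cval u = sqrt 2 * D" "D0 > 0" "u * lam_unit m = 1"
    using lam_pos lam_unit_mult[of "- m"] by (simp_all add: u_def D0_def D_def val_lam_unit)
  have absD: "\<bar>D\<bar> = lam powi m / sqrt 2" using abs_cval_lam_unit[of "- m"] by (simp add: D_def u_def)
  have Dlt: "\<bar>D\<bar> < 2 * max_tri_area W"
  proof -
    have "lam powi m < sqrt 2 * (2 * max_tri_area W)" using m by (simp add: mult_ac)
    then show ?thesis unfolding absD by (simp add: pos_divide_less_eq mult.commute)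
  qed
  have D: "D \<noteq> 0" using absD lam_pos by auto
  obtain w1 w2 where w: "w1 \<in> W" "w2 \<in> W" "Im (cnj w1 * w2) = D"
    using prescribed_determinant[OF W(2,4) Dlt D] .
  define v where "v = w2 - w1"
  have Dv: "Im (cnj w1 * v) = D" using w(3) by (simp add: v_def algebra_simps)
  then have v: "v \<noteq> 0" "w1 \<noteq> 0" using D by auto
  define \<tau> where "\<tau> = Re (w1 / v)"
  have w1: "w1 = Complex \<tau> (- D / (norm v)\<^sup>2) * v"
    using complex_polar_decomposition[OF v(1), of w1] unfolding Dv \<tau>_def .
  obtain \<delta> where \<delta>: "\<delta> > 0" "ball w1 \<delta> \<subseteq> W" "ball w2 \<delta> \<subseteq> W"
  proof -
    obtain a b where "a > 0" "ball w1 a \<subseteq> W" "b > 0" "ball w2 b \<subseteq> W"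
      using W(1) w open_contains_ball by metis
    then show ?thesis using that[of "min a b"] by (auto simp: subset_iff)
  qed
  \<comment> \<open>Radius \<delta> / 2 leaves room for adding \<open>cemb z\<close>, which is
    within \<delta> / 2 of v, so that the second point also stays in W. The other bound serves
    \<open>partner_unique\<close>.\<close>
  define U where "U = ball w1 (min (\<delta> / 2) (norm w1 / 10))"
  have U: "open U" "w1 \<in> U" using \<delta> v by (auto simp: U_def)
  obtain d where d: "d > 0" "\<And>\<tau>' z. \<bar>\<tau>' - \<tau>\<bar> < d \<Longrightarrow> norm (z - v) < d \<Longrightarrow> Complex \<tau>' (- D / (norm z)\<^sup>2) * z \<in> U"
    using stable_neighbourhood[OF v(1) U w1] by blast
  define r where "r = min (d / 2) (min (\<delta> / 2) (norm w1 / 10))"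
  have r: "r > 0" "r < d" "r \<le> \<delta> / 2" "r \<le> norm w1 / 10" using d \<delta> v by (auto simp: r_def)
  obtain L where L: "L > 0" "\<And>x y. \<exists>q. x \<le> val q \<and> val q \<le> x + L \<and> y \<le> cval q \<and> cval q \<le> y + r"
    using quad_window[OF r(1)] by blast
  \<comment> \<open>Gives (1 - 2 e)^2 \<ge> 1 - \<epsilon>, and 1 - 2 e \<ge> 9/10 as \<epsilon>
    \<le> 1/5.\<close>
  define e where "e = \<epsilon> / 4"
  have e: "0 < e" "e < 1 / 2" "e \<le> 1 / 20" using \<epsilon> by (auto simp: e_def)
  define \<eta> where "\<eta> = min (e / L) (e / 2)"
  have \<eta>: "\<eta> > 0" "\<eta> \<le> e / L" "\<eta> \<le> e / 2" unfolding \<eta>_def using e(1) L(1) by (simp_all del: min_less_iff_conj add: min_def)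
  \<comment> \<open>By \<open>norm_emb_cemb_ge\<close>, a lower bound for the length of a nonzero z
    whose conjugate is within r of v.\<close>
  define z0 where "z0 = 1 / (9 * (norm v + r))"
  have z0: "z0 > 0" using r by (simp add: z0_def add_nonneg_pos)
  obtain v1 v2 where vv: "v = of_real v1 + of_real v2 * zeta8 ^ 3" by (rule cemb_basis)
  define G where "G T = {z. primitive z \<and> \<bar>val (fst z)\<bar> \<le> T \<and> \<bar>val (snd z)\<bar> \<le> T \<and>
        \<bar>cval (fst z) - v1\<bar> < r / 2 \<and> \<bar>cval (snd z) - v2\<bar> < r / 2}" for T
  obtain c T1 where c: "c > 0" "\<And>T. T \<ge> T1 \<Longrightarrow> c * T\<^sup>2 \<le> real (card (G T))"
    using primitive_count[of "r / 2" v1 v2, folded G_def] half_gt_zero[OF r(1)] by blast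
  define T0 where "T0 = max (2 * T1 / \<eta>) (2 * D0 / (z0 * e)) + 1"
  have main: "\<exists>X \<subseteq> A_set W. c * \<eta>\<^sup>2 / 4 * T\<^sup>2 \<le> real (card X) \<and> inj_on Arg X \<and>
      (\<forall>x\<in>X. x \<noteq> 0 \<and> norm x < T \<and> (\<exists>y\<in>A_set W. norm y < T \<and>
        Im (cnj x * y) = D0 \<and> (1 - \<epsilon>) * T\<^sup>2 \<le> Re (cnj x * y)))"
    if T: "T \<ge> T0" for T
  proof -
    have T1: "T1 \<le> \<eta> * T / 2" "D0 / z0 < e / 2 * T" "T > 0"
    proof -
      have "2 * T1 / \<eta> \<le> T" "2 * D0 / (z0 * e) < T" using T by (simp_all add: T0_def)
      then show "T1 \<le> \<eta> * T / 2" "D0 / z0 < e / 2 * T"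
        using \<eta> e z0 by (simp_all add: pos_divide_le_eq pos_divide_less_eq mult_ac)
      then have "0 < e / 2 * T" using u(3) z0 by (meson divide_pos_pos less_trans)
      then show "T > 0" using e by (simp add: zero_less_mult_iff)
    qed
    define P where "P z x \<longleftrightarrow> qdet x z = u \<and> cemb x \<in> U \<and> norm (emb x) < T \<and> norm (emb x + emb z) < T \<and>
      norm (emb x) \<ge> 9/10 * T \<and> Re (cnj (emb x) * (emb x + emb z)) \<ge> (1 - \<epsilon>) * T\<^sup>2" for z x
    have Gz: "primitive z" "norm (emb z) \<le> \<eta> * T" "norm (cemb z - v) < r" if "z \<in> G (\<eta> * T / 2)" for z
    proof -
      show "primitive z" using that by (simp add: G_def)
      show "norm (emb z) \<le> \<eta> * T" using that norm_emb_le[of z] by (simp add: G_def)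
      show "norm (cemb z - v) < r" using that norm_cemb_diff_le[of z v1 v2] by (simp add: G_def vv)
    qed
    have ex: "\<exists>x. P z x" if "z \<in> G (\<eta> * T / 2)" for z
    proof -
      note g = Gz[OF that]
      have n1: "norm (emb z) \<le> e / L * T" using g(2) \<eta>(2) T1(3) by (meson less_imp_le mult_right_mono order_trans)
      have n2: "norm (emb z) \<le> e / 2 * T" using g(2) \<eta>(3) T1(3) by (meson less_imp_le mult_right_mono order_trans)
      have "z \<noteq> 0" using g(1) by (auto simp: primitive_def qdet_def)
      then have "1 \<le> 9 * (norm (emb z) * norm (cemb z))" by (rule norm_emb_cemb_ge)
      also have "\<dots> \<le> 9 * (norm (emb z) * (norm v + r))"
        using g(3) norm_triangle_ineq2[of "cemb z" v] by (intro mult_left_mono) auto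
      finally have n3: "norm (emb z) \<ge> z0"
        using r by (simp add: z0_def pos_divide_le_eq add_nonneg_pos mult_ac)
      obtain x \<tau>' where x: "qdet x z = u" "\<tau> \<le> \<tau>'" "\<tau>' \<le> \<tau> + r"
        "cemb x = Complex \<tau>' (- D / (norm (cemb z))\<^sup>2) * cemb z"
        "norm (emb x) < T" "norm (emb x + emb z) < T" "norm (emb x) \<ge> (1 - 2 * e) * T"
        "Re (cnj (emb x) * (emb x + emb z)) \<ge> (1 - 2 * e)\<^sup>2 * T\<^sup>2"
        using partner_exists[OF g(1) n1 n2 e(1,2) T1(3) n3 z0 T1(2) L u(1-3)] .
      have "cemb x \<in> U" unfolding x(4) using x(2,3) g(3) r by (intro d(2)) auto
      moreover have "9/10 * T \<le> (1 - 2 * e) * T" using e T1 by (intro mult_right_mono) auto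
      moreover have "(1 - \<epsilon>) * T\<^sup>2 \<le> (1 - 2 * e)\<^sup>2 * T\<^sup>2"
        by (intro mult_right_mono) (auto simp: e_def power2_eq_square algebra_simps)
      ultimately have "P z x" using x unfolding P_def by linarith
      then show ?thesis by blast
    qed
    then obtain f where f: "\<And>z. z \<in> G (\<eta> * T / 2) \<Longrightarrow> P z (f z)" by metis
    have inj: "z = z'" if z: "z \<in> G (\<eta> * T / 2)" "z' \<in> G (\<eta> * T / 2)" and A: "Arg (emb (f z)) = Arg (emb (f z'))" for z z'
    proof -
      note P = f[OF z(1), unfolded P_def] f[OF z(2), unfolded P_def]
      note g = Gz[OF z(1)] Gz[OF z(2)]
      have "\<eta> * T \<le> 1 / 20 * T" using \<eta> e T1 by (intro mult_right_mono) auto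
      then have Z: "norm (emb z) \<le> T / 20" "norm (emb z') \<le> T / 20" using g by linarith+
      show ?thesis
        by (rule partner_unique[where w = w1 and b = v and T = T, OF _ _ u(4) A])
          (use P g Z T1 r in \<open>auto simp: U_def dist_norm norm_minus_commute\<close>)
    qed
    define X where "X = (\<lambda>z. emb (f z)) ` G (\<eta> * T / 2)"
    have "inj_on (\<lambda>z. emb (f z)) (G (\<eta> * T / 2))" using inj by (auto simp: inj_on_def)
    then have "card X = card (G (\<eta> * T / 2))" unfolding X_def by (rule card_image)
    moreover have "c * (\<eta> * T / 2)\<^sup>2 \<le> real (card (G (\<eta> * T / 2)))" using c(2) T1 by blast
    ultimately have card: "c * \<eta>\<^sup>2 / 4 * T\<^sup>2 \<le> real (card X)" by (simp add: power_mult_distrib power_divide)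
    have injA: "inj_on Arg X" using inj by (auto simp: inj_on_def X_def)
    have UW: "p \<in> W" if "p \<in> U" for p
      using that \<delta> by (auto simp: U_def subset_iff)
    have props: "emb (f z) \<in> A_set W \<and> emb (f z) \<noteq> 0 \<and> norm (emb (f z)) < T \<and>
       (\<exists>y\<in>A_set W. norm y < T \<and> Im (cnj (emb (f z)) * y) = D0 \<and> (1 - \<epsilon>) * T\<^sup>2 \<le> Re (cnj (emb (f z)) * y))"
      if "z \<in> G (\<eta> * T / 2)" for z
    proof -
      note P = f[OF that, unfolded P_def]
      note g = Gz[OF that]
      have "cemb (f z) \<in> W" using P UW by blast
      then have 1: "emb (f z) \<in> A_set W" by (simp add: emb_in_A_set_iff)
      have "norm (cemb (f z) - w1) < \<delta> / 2" using P by (simp add: U_def dist_norm norm_minus_commute)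
      moreover have "norm (cemb z - v) < \<delta> / 2" using g r by linarith
      moreover have "cemb (f z + z) - w2 = (cemb (f z) - w1) + (cemb z - v)" by (simp add: cemb_add v_def)
      ultimately have "norm (cemb (f z + z) - w2) < \<delta>"
        using norm_triangle_ineq[of "cemb (f z) - w1" "cemb z - v"] by simp
      then have "cemb (f z + z) \<in> W" using \<delta>(3) by (auto simp: subset_iff dist_norm norm_minus_commute)
      then have 2: "emb (f z) + emb z \<in> A_set W" by (simp add: emb_in_A_set_iff flip: emb_add)
      have "Im (cnj (emb (f z)) * (emb (f z) + emb z)) = Im (cnj (emb (f z)) * emb z)"
        by (simp add: algebra_simps)
      also have "\<dots> = D0" unfolding Im_emb using P by (simp add: u)
      finally have 3: "Im (cnj (emb (f z)) * (emb (f z) + emb z)) = D0" .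
      have 4: "emb (f z) \<noteq> 0" using 3 u(3) by auto
      show ?thesis using 1 2 3 4 P by blast
    qed
    show ?thesis using card injA props by (intro exI[of _ X]) (auto simp: X_def)
  qed
  show ?thesis
    by (rule that[of "c * \<eta>\<^sup>2 / 4" T0]) (use c \<eta> main in \<open>simp_all add: D0_def\<close>)
qed

section \<open>Gaps between directions\<close>

lemma zero_notin_visible: "0 \<notin> visible P"
  unfolding visible_def using zero_less_one[where 'a = real] by (auto intro!: exI[of _ "1/2::real"])

lemma finite_visible_upto:
  assumes "finite {x \<in> P. norm x < T}"
  shows "finite (visible_upto P T)"
  by (rule finite_subset[OF _ assms]) (auto simp: visible_upto_def visible_def)

lemma polar_same_Arg:
  assumes "Arg x = Arg y" "y \<noteq> 0"
  shows "x = of_real (norm x / norm y) * y"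
proof -
  have "x = of_real (norm x) * cis (Arg y)" "y = of_real (norm y) * cis (Arg y)"
    using rcis_cmod_Arg[of x] rcis_cmod_Arg[of y] assms by (simp_all add: rcis_def)
  then show ?thesis using assms by (metis nonzero_mult_div_cancel_left norm_eq_zero of_real_divide
    of_real_eq_0_iff times_divide_eq_left times_divide_eq_right)
qed

lemma inj_on_Arg_visible: "inj_on Arg (visible P)"
proof (rule inj_onI, rule ccontr)
  have *: False if xy: "x \<in> visible P" "y \<in> visible P" "Arg x = Arg y" "norm x < norm y" for x y
  proof -
    have nz: "x \<noteq> 0" "y \<noteq> 0" using zero_notin_visible xy by blast+
    have "x = (norm x / norm y) *\<^sub>R y" using polar_same_Arg[OF xy(3) nz(2)] by (simp add: scaleR_conv_of_real)
    moreover have "0 < norm x / norm y" "norm x / norm y < 1" using nz xy by simp_all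
    ultimately show False using xy(1,2) unfolding visible_def by auto
  qed
  fix x y assume xy: "x \<in> visible P" "y \<in> visible P" "Arg x = Arg y" "x \<noteq> y"
  have "norm x \<noteq> norm y"
  proof
    assume "norm x = norm y"
    then have "x = y" using xy(3) by (metis rcis_cmod_Arg)
    then show False using xy by simp
  qed
  then show False using *[of x y] *[of y x] xy by fastforce
qed

text \<open>The shortest of the finitely many points on the ray is visible. This lets arbitrary
  points of P stand for directions.\<close>

lemma visible_representative:
  assumes fin: "finite {x \<in> P. norm x < T}" and w: "w \<in> P" "w \<noteq> 0" "norm w < T"
  obtains x where "x \<in> visible_upto P T" "Arg x = Arg w"
proof -
  define A where "A = {x \<in> P. norm x < T \<and> x \<noteq> 0 \<and> Arg x = Arg w}"
  have A: "finite A" "A \<noteq> {}" using w finite_subset[OF _ fin, of A] by (auto simp: A_def)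
  obtain x where x: "x \<in> A" "\<And>y. y \<in> A \<Longrightarrow> norm x \<le> norm y"
    using arg_min_if_finite(1,2)[OF A, of norm] by (metis not_le)
  have "x \<in> visible P" unfolding visible_def
  proof (intro CollectI conjI allI impI notI)
    show "x \<in> P" using x by (simp add: A_def)
    fix t :: real assume t: "0 < t \<and> t < 1" "t *\<^sub>R x \<in> P"
    have "norm (t *\<^sub>R x) < norm x" using t x by (simp add: A_def)
    moreover have "Arg (t *\<^sub>R x) = Arg w" using t x by (simp add: A_def scaleR_conv_of_real)
    ultimately have "t *\<^sub>R x \<in> A" using t x(1) unfolding A_def mem_Collect_eq
      by (metis less_irrefl less_trans scaleR_eq_0_iff)
    then show False using x(2) \<open>norm (t *\<^sub>R x) < norm x\<close> by fastforce
  qed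
  then show ?thesis using that[of x] x by (auto simp: A_def visible_upto_def)
qed

lemma directions_props:
  assumes fin: "finite {x \<in> P. norm x < T}"
  shows "set (directions P T) = (\<lambda>x. Arg x / (2 * pi)) ` visible_upto P T"
    and "sorted_wrt (<) (directions P T)" and "length (directions P T) = num_visible P T"
proof -
  have f: "finite (visible_upto P T)" by (rule finite_visible_upto[OF fin])
  have "inj_on Arg (visible_upto P T)"
    by (rule inj_on_subset[OF inj_on_Arg_visible]) (auto simp: visible_upto_def)
  then have "inj_on (\<lambda>x. Arg x / (2 * pi)) (visible_upto P T)" by (auto simp: inj_on_def)
  then have "card ((\<lambda>x. Arg x / (2 * pi)) ` visible_upto P T) = num_visible P T"
    unfolding num_visible_def by (rule card_image)
  then show "set (directions P T) = (\<lambda>x. Arg x / (2 * pi)) ` visible_upto P T"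
    "sorted_wrt (<) (directions P T)" "length (directions P T) = num_visible P T"
    using f by (simp_all add: directions_def)
qed

lemma direction_step:
  assumes fin: "finite {x \<in> P. norm x < T}" and i: "i \<in> {1..num_visible P T}"
  obtains x y where "x \<in> visible_upto P T" "y \<in> visible_upto P T"
    "0 < direction P T i - direction P T (i - 1)"
    "cnj x * y = of_real (norm x * norm y) * cis (2 * pi * (direction P T i - direction P T (i - 1)))"
proof -
  note D = directions_props[OF fin]
  let ?D = "directions P T" and ?N = "num_visible P T"
  have vis: "\<exists>x\<in>visible_upto P T. ?D ! j = Arg x / (2 * pi)" if "j < ?N" for j
    using D(1,3) that nth_mem[of j ?D] by auto
  have prod: "cnj x * y = of_real (norm x * norm y) * cis (Arg y - Arg x)" for x y
  proof -
    have "cnj x * y = cnj (rcis (norm x) (Arg x)) * rcis (norm y) (Arg y)" by (simp add: rcis_cmod_Arg)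
    also have "\<dots> = of_real (norm x * norm y) * (cis (- Arg x) * cis (Arg y))"
      by (simp add: rcis_def cis_cnj)
    finally show ?thesis by (simp add: cis_mult)
  qed
  show ?thesis
  proof (cases "i = 1")
    case True
    obtain x where x: "x \<in> visible_upto P T" "?D ! (?N - 1) = Arg x / (2 * pi)" using vis[of "?N - 1"] i by auto
    obtain y where y: "y \<in> visible_upto P T" "?D ! 0 = Arg y / (2 * pi)" using vis[of 0] i by auto
    \<comment> \<open>\<open>direction P T 0\<close> is the last direction minus 1, hence a full
      turn is added, which \<open>cis\<close> ignores. The sum is positive because
      \<open>Arg\<close> takes values in (-pi, pi].\<close>
    have g: "direction P T i - direction P T (i - 1) = (Arg y - Arg x) / (2 * pi) + 1"
      using x y by (simp add: True direction_def diff_divide_distrib)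
    then have "2 * pi * (direction P T i - direction P T (i - 1)) = (Arg y - Arg x) + 2 * pi"
      by (simp add: distrib_left)
    then have "cis (2 * pi * (direction P T i - direction P T (i - 1))) = cis (Arg y - Arg x)"
      by (simp flip: cis_mult)
    moreover have "0 < direction P T i - direction P T (i - 1)"
      using Arg_bounded[of x] Arg_bounded[of y] unfolding g by (simp add: field_simps)
    ultimately show ?thesis using that[OF x(1) y(1)] prod by simp
  next
    case False
    then have i2: "i \<ge> 2" "i \<le> ?N" using i by auto
    obtain x where x: "x \<in> visible_upto P T" "?D ! (i - 2) = Arg x / (2 * pi)" 
    proof -
      have "i - 2 < ?N" using i2 by linarith
      then show ?thesis using vis that by blast
    qed
    obtain y where y: "y \<in> visible_upto P T" "?D ! (i - 1) = Arg y / (2 * pi)" 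
    proof -
      have "i - 1 < ?N" using i2 by linarith
      then show ?thesis using vis that by blast
    qed
    have "i - 1 - 1 = i - 2" by simp
    then have dir: "direction P T (i - 1) = ?D ! (i - 2)" "direction P T i = ?D ! (i - 1)"
      using i2 by (simp_all add: direction_def)
    then have g: "2 * pi * (direction P T i - direction P T (i - 1)) = Arg y - Arg x"
      using x y by (simp add: right_diff_distrib)
    have "?D ! (i - 2) < ?D ! (i - 1)" by (rule sorted_wrt_nth_less[OF D(2)]) (use D(3) i2 in auto)
    then show ?thesis using that[OF x(1) y(1)] prod[of x y] dir unfolding g by simp
  qed
qed

text \<open>Two consecutive directions at an angle \<theta> < pi have determinant |x| |y| sin
  \<theta> > 0, which is at least K and at most T^2 \<theta>. Larger angles are covered by the
  \<open>min\<close> with pi.\<close>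

lemma gap_ge:
  assumes fin: "finite {x \<in> P. norm x < T}" and T: "T > 0" and K: "K \<ge> 0"
    and det: "\<And>x y. x \<in> P \<Longrightarrow> y \<in> P \<Longrightarrow> Im (cnj x * y) \<noteq> 0 \<Longrightarrow> K \<le> \<bar>Im (cnj x * y)\<bar>"
    and i: "i \<in> {1..num_visible P T}"
  shows "gap P T i \<ge> real (num_visible P T) * (min pi (K / T\<^sup>2) / (2 * pi))"
proof -
  obtain x y where xy: "x \<in> visible_upto P T" "y \<in> visible_upto P T"
    "0 < direction P T i - direction P T (i - 1)"
    "cnj x * y = of_real (norm x * norm y) * cis (2 * pi * (direction P T i - direction P T (i - 1)))"
    using direction_step[OF fin i] .
  define \<theta> where "\<theta> = 2 * pi * (direction P T i - direction P T (i - 1))"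
  have \<theta>: "\<theta> > 0" using xy(3) by (simp add: \<theta>_def)
  have xyP: "x \<in> P" "y \<in> P" "norm x < T" "norm y < T" "x \<noteq> 0" "y \<noteq> 0"
    using xy(1,2) zero_notin_visible[of P] by (auto simp: visible_upto_def) (auto simp: visible_def)
  have "min pi (K / T\<^sup>2) \<le> \<theta>"
  proof (cases "\<theta> < pi")
    case True
    then have s: "sin \<theta> > 0" using \<theta> by (simp add: sin_gt_zero)
    have I: "Im (cnj x * y) = norm x * norm y * sin \<theta>"
      unfolding xy(4) \<theta>_def[symmetric] by simp
    have pos: "0 < norm x * norm y * sin \<theta>" using s xyP by simp
    then have "K \<le> norm x * norm y * sin \<theta>" using det[OF xyP(1,2)] unfolding I by (metis abs_of_pos less_irrefl)
    also have "\<dots> \<le> T * T * sin \<theta>" using xyP s T by (intro mult_right_mono mult_mono) auto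
    also have "\<dots> \<le> T\<^sup>2 * \<theta>" unfolding power2_eq_square using \<theta> T sin_x_le_x[of \<theta>] by (intro mult_left_mono) auto
    finally have "K / T\<^sup>2 \<le> \<theta>" using T by (simp add: pos_divide_le_eq mult.commute)
    then show ?thesis by simp
  qed auto
  then have "min pi (K / T\<^sup>2) / (2 * pi) \<le> \<theta> / (2 * pi)" by (intro divide_right_mono) auto
  then have "min pi (K / T\<^sup>2) / (2 * pi) \<le> direction P T i - direction P T (i - 1)" by (simp add: \<theta>_def)
  then show ?thesis unfolding gap_def by (intro mult_left_mono) auto
qed

text \<open>Beyond the direction of \<open>x\<close> the next one is at most that of \<open>y\<close>, unless the angle from \<open>x\<close>
  to \<open>y\<close> crosses the branch cut of \<^term>\<open>Arg\<close>; then every later direction is still within that angle.\<close>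

lemma direction_after:
  assumes fin: "finite {x \<in> P. norm x < T}"
    and x: "x \<in> P" "x \<noteq> 0" "norm x < T" and y: "y \<in> P" "norm y < T"
    and K: "Im (cnj x * y) = K" "K > 0" and R: "R \<le> Re (cnj x * y)" "R > 0"
    and j: "j + 1 < num_visible P T" "directions P T ! j = Arg x / (2 * pi)"
  shows "directions P T ! (j + 1) - directions P T ! j \<le> K / R / (2 * pi)"
proof -
  note D = directions_props[OF fin]
  let ?D = "directions P T"
  define \<phi> where "\<phi> = Arg (cnj x * y)"
  have y0: "y \<noteq> 0" using K by auto
  have \<phi>: "\<phi> = arctan (K / Re (cnj x * y))" unfolding \<phi>_def using R K(1)
    by (subst arg_conv_arctan) auto
  have Rp: "Re (cnj x * y) > 0" using R by linarith
  have \<phi>0: "\<phi> > 0" unfolding \<phi> using K Rp by (subst zero_less_arctan_iff) (simp add: divide_pos_pos)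
  have "\<phi> \<le> K / Re (cnj x * y)" unfolding \<phi> using K Rp by (intro arctan_le_self) (simp add: divide_nonneg_nonneg)
  also have "\<dots> \<le> K / R" using K R by (intro divide_left_mono) auto
  finally have \<phi>K: "\<phi> \<le> K / R" .
  have ylt: "Arg y = Arg x + \<phi>" if "Arg x + \<phi> \<le> pi"
  proof -
    \<comment> \<open>The positive factor |x|^2 leaves the argument of y unchanged, so it is the
      argument of a product, where arguments add as long as the sum is at most pi.\<close>
    have e: "x * (cnj x * y) = of_real ((norm x)\<^sup>2) * y"
      unfolding complex_norm_square by (simp add: mult_ac)
    have "Arg y = Arg (of_real ((norm x)\<^sup>2) * y)" using x by (intro Arg_times_of_real[symmetric]) simp
    also have "\<dots> = Arg x + \<phi>" unfolding e[symmetric] \<phi>_def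
      by (subst Arg_times') (use that x y0 \<phi>0 Arg_bounded[of x] in \<open>auto simp: \<phi>_def\<close>)
    finally show ?thesis .
  qed
  have bound: "?D ! (j + 1) * (2 * pi) \<le> Arg x + \<phi>"
  proof (cases "Arg x + \<phi> \<le> pi")
    case True
    obtain y' where y': "y' \<in> visible_upto P T" "Arg y' = Arg y"
      using visible_representative[OF fin y(1) y0 y(2)] .
    have "Arg y / (2 * pi) \<in> set ?D" unfolding D(1) y'(2)[symmetric] using y'(1) by (rule imageI)
    then obtain k where k: "k < num_visible P T" "?D ! k = Arg y / (2 * pi)"
      unfolding in_set_conv_nth D(3) by blast
    have "?D ! j < ?D ! k" unfolding k j(2) ylt[OF True] using \<phi>0 by (intro divide_strict_right_mono) auto
    then have "j < k" using k j D by (metis add_lessD1 linorder_neqE_nat not_less_iff_gr_or_eq sorted_wrt_nth_less)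
    then have "?D ! (j + 1) \<le> ?D ! k"
      using sorted_wrt_nth_less[OF D(2), of "j + 1" k] D(3) k by (cases "j + 1 = k") auto
    then show ?thesis unfolding k ylt[OF True] by (simp add: field_simps)
  next
    case False
    have "?D ! (j + 1) \<in> set ?D" by (rule nth_mem) (use j D(3) in simp)
    then obtain u where "?D ! (j + 1) = Arg u / (2 * pi)" unfolding D(1) by auto
    then show ?thesis using Arg_bounded[of u] False by (simp; linarith)
  qed
  have "?D ! (j + 1) - ?D ! j \<le> \<phi> / (2 * pi)"
  proof -
    have "?D ! (j + 1) \<le> (Arg x + \<phi>) / (2 * pi)" using bound by (subst pos_le_divide_eq) auto
    then show ?thesis unfolding j(2) by (simp add: add_divide_distrib)
  qed
  also have "\<dots> \<le> K / R / (2 * pi)" using \<phi>K by (intro divide_right_mono) auto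
  finally show ?thesis .
qed

text \<open>Each ray through X contains a visible point, hence gives a listed direction, and the gap
  after it is small. The last direction has no successor in the list and accounts for the 1.\<close>

lemma card_small_gaps:
  assumes fin: "finite {x \<in> P. norm x < T}" and inj: "inj_on Arg X" "X \<subseteq> P"
    and K: "K > 0" "R > 0"
    and X: "\<And>x. x \<in> X \<Longrightarrow> x \<noteq> 0 \<and> norm x < T \<and> (\<exists>y\<in>P. norm y < T \<and> Im (cnj x * y) = K \<and> R \<le> Re (cnj x * y))"
  shows "real (card X) \<le> 1 + real (card {i \<in> {1..num_visible P T}. gap P T i \<le> real (num_visible P T) * (K / R / (2 * pi))})"
    (is "_ \<le> 1 + real (card ?S)")
proof -
  note D = directions_props[OF fin]
  let ?D = "directions P T" and ?N = "num_visible P T"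
  have sub: "(\<lambda>x. Arg x / (2 * pi)) ` X \<subseteq> insert (?D ! (?N - 1)) ((\<lambda>i. ?D ! (i - 2)) ` ?S)"
  proof
    fix a assume "a \<in> (\<lambda>x. Arg x / (2 * pi)) ` X"
    then obtain x where x: "x \<in> X" "a = Arg x / (2 * pi)" by blast
    obtain y where y: "y \<in> P" "norm y < T" "Im (cnj x * y) = K" "R \<le> Re (cnj x * y)" using X x by blast
    have xP: "x \<in> P" "x \<noteq> 0" "norm x < T" using x X inj by auto
    obtain x' where x': "x' \<in> visible_upto P T" "Arg x' = Arg x" using visible_representative[OF fin xP] .
    have "a \<in> set ?D" unfolding D(1) x(2) x'(2)[symmetric] using x'(1) by (rule imageI)
    then obtain j where j: "j < ?N" "?D ! j = a" unfolding in_set_conv_nth D(3) by blast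
    show "a \<in> insert (?D ! (?N - 1)) ((\<lambda>i. ?D ! (i - 2)) ` ?S)"
    proof (cases "j + 1 < ?N")
      case False
      then have "j = ?N - 1" using j by simp
      then show ?thesis using j by simp
    next
      case True
      have "?D ! (j + 1) - ?D ! j \<le> K / R / (2 * pi)"
        using direction_after[OF fin xP y(1-3) K(1) y(4) K(2) True] j x by simp
      \<comment> \<open>The list is indexed from 0 and \<open>direction\<close> from 1, so the gap
        after list entry j has index j + 2.\<close>
      moreover have "gap P T (j + 2) = real ?N * (?D ! (j + 1) - ?D ! j)" by (simp add: gap_def direction_def)
      ultimately have "gap P T (j + 2) \<le> real ?N * (K / R / (2 * pi))"
        by (simp only:) (intro mult_left_mono; simp)
      then have "j + 2 \<in> ?S" using True by simp
      then have "?D ! (j + 2 - 2) \<in> (\<lambda>i. ?D ! (i - 2)) ` ?S" by (rule imageI)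
      then show ?thesis using j by simp
    qed
  qed
  have "inj_on (\<lambda>x. Arg x / (2 * pi)) X" using inj by (auto simp: inj_on_def)
  then have "card X = card ((\<lambda>x. Arg x / (2 * pi)) ` X)" by (simp add: card_image)
  also have "\<dots> \<le> card (insert (?D ! (?N - 1)) ((\<lambda>i. ?D ! (i - 2)) ` ?S))" using sub by (intro card_mono) auto
  also have "\<dots> \<le> Suc (card ((\<lambda>i. ?D ! (i - 2)) ` ?S))" by (simp add: card_insert_if)
  also have "\<dots> \<le> Suc (card ?S)" by (simp add: card_image_le)
  finally show ?thesis by simp
qed

section \<open>Gap counts as distribution functions, and the number of visible points\<close>

lemma cdf_gap_measure:
  "cdf (gap_measure P T) s = real (card {i \<in> {1..num_visible P T}. gap P T i \<le> s}) / real (num_visible P T)"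
proof -
  let ?M = "uniform_count_measure {1..num_visible P T}"
  have m: "gap P T \<in> measurable ?M borel"
    by (simp add: measurable_def space_uniform_count_measure sets_uniform_count_measure)
  have "cdf (gap_measure P T) s = measure ?M (gap P T -` {..s} \<inter> space ?M)"
    unfolding cdf_def2 gap_measure_def using m by (subst measure_distr) auto
  also have "gap P T -` {..s} \<inter> space ?M = {i \<in> {1..num_visible P T}. gap P T i \<le> s}"
    by (auto simp: space_uniform_count_measure)
  also have "measure ?M \<dots> = real (card {i \<in> {1..num_visible P T}. gap P T i \<le> s}) / real (num_visible P T)"
    by (subst measure_uniform_count_measure) auto
  finally show ?thesis .
qed

lemma num_visible_density:
  assumes "has_density (visible P) \<theta>"
  shows "((\<lambda>T. real (num_visible P T) / (pi * T\<^sup>2)) \<longlongrightarrow> \<theta>) at_top"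
proof -
  have jm: "jordan_measurable (ball (0::complex) 1)"
    by (simp add: jordan_measurable_def negligible_sphere flip: negligible_iff_null_sets)
  have vol: "measure lebesgue (ball (0::complex) T) = pi * T\<^sup>2" if "T > 0" for T
    using that by (simp add: measure_completion content_ball eval_unit_ball_vol)
  have lim: "((\<lambda>T. real (card (visible P \<inter> (*\<^sub>R) T ` ball 0 1)) / measure lebesgue ((*\<^sub>R) T ` ball (0::complex) 1)) \<longlongrightarrow> \<theta>) at_top"
    using assms[unfolded has_density_def, rule_format, of "ball 0 1"] jm vol[of 1] by simp
  show ?thesis
  proof (rule Lim_transform_eventually[OF lim])
    show "eventually (\<lambda>T. real (card (visible P \<inter> (*\<^sub>R) T ` ball 0 1)) / measure lebesgue ((*\<^sub>R) T ` ball (0::complex) 1)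
        = real (num_visible P T) / (pi * T\<^sup>2)) at_top"
      using eventually_gt_at_top[of 0]
    proof eventually_elim
      case (elim T)
      have b: "(*\<^sub>R) T ` ball (0::complex) 1 = ball 0 T" using elim ball_scale[of T "0::complex" 1] by simp
      have "visible P \<inter> ball 0 T = visible_upto P T" by (auto simp: visible_upto_def)
      then show ?case unfolding b using vol[OF elim] by (simp add: num_visible_def)
    qed
  qed
qed

section \<open>The minimal gap\<close>

lemma real_distribution_isCont_between:
  assumes "real_distribution \<mu>" "a < b"
  obtains x where "a < x" "x < b" "isCont (cdf \<mu>) x"
proof -
  interpret real_distribution \<mu> by fact
  have "countable {x. \<not> isCont (cdf \<mu>) x}"
    using countable_atoms by (simp add: isCont_cdf measure_nonneg less_le eq_commute[of 0])
  moreover have "uncountable {a<..<b}" using assms(2) by (rule uncountable_open_interval[THEN iffD2])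
  ultimately have "\<not> {a<..<b} \<subseteq> {x. \<not> isCont (cdf \<mu>) x}" using countable_subset by blast
  then show ?thesis using that by auto
qed

text \<open>Weak convergence gives limits of the distribution functions only at continuity points,
  so each bound is used at such a point strictly between s and M. The uniform d survives the limit
  and pushes the tail below 1. The tail at M itself does not affect the supremum.\<close>

lemma min_gap_eq:
  fixes P :: "complex set"
  assumes \<mu>: "has_gap_limit P \<mu>" and M: "M > 0"
    and lower: "\<And>s. s < M \<Longrightarrow> eventually (\<lambda>T. cdf (gap_measure P T) s = 0) at_top"
    and upper: "\<And>s. s > M \<Longrightarrow> \<exists>d>0. eventually (\<lambda>T. cdf (gap_measure P T) s \<ge> d) at_top"
  shows "min_gap P = M"
proof -
  interpret real_distribution \<mu> using \<mu> by (simp add: has_gap_limit_def)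
  have lim: "(\<lambda>n. cdf (gap_measure P (real n)) x) \<longlonglongrightarrow> cdf \<mu> x" if "isCont (cdf \<mu>) x" for x
    using \<mu> filterlim_real_sequentially that
    unfolding has_gap_limit_def weak_conv_m_def weak_conv_def by blast
  have tail: "gap_tail P s = 1 - measure \<mu> {..<s}" for s
  proof -
    have "{s..} = space \<mu> - {..<s}" by auto
    then show ?thesis unfolding gap_tail_def gap_limit_eq[OF \<mu>] using prob_compl[of "{..<s}"] by simp
  qed
  have one: "gap_tail P s = 1" if s: "s < M" for s
  proof -
    obtain x where x: "s < x" "x < M" "isCont (cdf \<mu>) x"
      using real_distribution_isCont_between[OF real_distribution_axioms s] .
    have "eventually (\<lambda>n. cdf (gap_measure P (real n)) x = 0) sequentially"
      using lower[OF x(2)] filterlim_real_sequentially by (rule eventually_compose_filterlim)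
    then have "(\<lambda>n. cdf (gap_measure P (real n)) x) \<longlonglongrightarrow> 0" by (rule tendsto_eventually)
    then have "measure \<mu> {..x} = 0" using LIMSEQ_unique lim[OF x(3)] by (auto simp: cdf_def2)
    moreover have "measure \<mu> {..<s} \<le> measure \<mu> {..x}" using x by (intro finite_measure_mono) auto
    ultimately have "measure \<mu> {..<s} = 0" using measure_nonneg[of \<mu> "{..<s}"] by linarith
    then show ?thesis by (simp add: tail)
  qed
  have less: "gap_tail P s < 1" if s: "s > M" for s
  proof -
    obtain x where x: "M < x" "x < s" "isCont (cdf \<mu>) x"
      using real_distribution_isCont_between[OF real_distribution_axioms s] .
    obtain d where d: "d > 0" "eventually (\<lambda>T. cdf (gap_measure P T) x \<ge> d) at_top" using upper[OF x(1)] by blast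
    have "eventually (\<lambda>n. cdf (gap_measure P (real n)) x \<ge> d) sequentially"
      using d(2) filterlim_real_sequentially by (rule eventually_compose_filterlim)
    then have "d \<le> measure \<mu> {..x}" using tendsto_lowerbound[OF lim[OF x(3)]] by (simp add: cdf_def2)
    also have "\<dots> \<le> measure \<mu> {..<s}" using x by (intro finite_measure_mono) auto
    finally show ?thesis using d by (simp add: tail)
  qed
  let ?Q = "{\<sigma>. 0 \<le> \<sigma> \<and> (\<forall>s\<in>{0..\<sigma>}. gap_tail P s = 1)}"
  have le: "\<sigma> \<le> M" if "\<sigma> \<in> ?Q" for \<sigma>
  proof (rule ccontr)
    assume "\<not> \<sigma> \<le> M"
    then have "gap_tail P \<sigma> < 1" by (intro less) simp
    moreover have "gap_tail P \<sigma> = 1" using that by auto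
    ultimately show False by simp
  qed
  have mem: "\<sigma> \<in> ?Q" if "0 \<le> \<sigma>" "\<sigma> < M" for \<sigma> using that one by auto
  have "M \<le> Sup ?Q"
  proof (rule dense_le_bounded[OF M])
    fix \<sigma> assume "0 < \<sigma>" "\<sigma> < M"
    then have "\<sigma> \<in> ?Q" by (intro mem) auto
    then show "\<sigma> \<le> Sup ?Q" using le by (intro cSup_upper bdd_aboveI) auto
  qed
  moreover have "Sup ?Q \<le> M" using mem[of 0] M le by (intro cSup_least) auto
  ultimately show ?thesis unfolding min_gap_def by simp
qed

theorem theorem5p5:
  fixes W :: "complex set" and m :: int
  assumes "open W" and "convex W" and "jordan_measurable W" and "0 \<in> W"
    and gap_limit_exists: "\<exists>\<mu>. has_gap_limit (A_set W) \<mu>"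
    and density_exists: "\<exists>\<theta>. has_density (visible (A_set W)) \<theta>"
    and "m = (GREATEST k::int. lam powi k < 2 * sqrt 2 * max_tri_area W)"
  shows "min_gap (A_set W) = lam powi (- m) * density_of (visible (A_set W)) / (2 * sqrt 2)"
proof -
  define A where "A = A_set W"
  obtain \<mu> where \<mu>: "has_gap_limit A \<mu>" using gap_limit_exists by (auto simp: A_def)
  obtain \<theta> where \<theta>: "has_density (visible A) \<theta>" using density_exists by (auto simp: A_def)
  have bW: "bounded W" using assms(3) by (simp add: jordan_measurable_def)
  have fin: "finite {x \<in> A. norm x < T}" for T unfolding A_def by (rule finite_A_set_ball[OF bW])
  have "2 * sqrt 2 * max_tri_area W > 0" using max_tri_area_pos[OF assms(1) bW assms(4)] by simp
  note m = greatest_lam_powi[OF this assms(7)]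
  define K where "K = lam powi (- m) / sqrt 2"
  have K: "K > 0" using lam_pos by (simp add: K_def)
  define N where "N T = real (num_visible A T)" for T
  have lim: "((\<lambda>T. N T / (pi * T\<^sup>2)) \<longlongrightarrow> \<theta>) at_top" unfolding N_def by (rule num_visible_density[OF \<theta>])
  have pairs: "\<exists>c>0. eventually (\<lambda>T. c * T\<^sup>2 \<le> 1 + real (card {i \<in> {1..num_visible A T}.
      gap A T i \<le> N T * (K / ((1 - \<epsilon>) * T\<^sup>2) / (2 * pi))})) at_top"
    if \<epsilon>: "0 < \<epsilon>" "\<epsilon> \<le> 1 / 5" for \<epsilon>
  proof -
    obtain c T0 where c: "c > 0"
      "\<And>T. T \<ge> T0 \<Longrightarrow> \<exists>X \<subseteq> A_set W. c * T\<^sup>2 \<le> real (card X) \<and> inj_on Arg X \<and>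
      (\<forall>x\<in>X. x \<noteq> 0 \<and> norm x < T \<and> (\<exists>y\<in>A_set W. norm y < T \<and>
        Im (cnj x * y) = lam powi (- m) / sqrt 2 \<and> (1 - \<epsilon>) * T\<^sup>2 \<le> Re (cnj x * y)))"
      using many_close_pairs[OF assms(1,2) bW assms(4) m(1) \<epsilon>] by blast
    have "c * T\<^sup>2 \<le> 1 + real (card {i \<in> {1..num_visible A T}.
      gap A T i \<le> N T * (K / ((1 - \<epsilon>) * T\<^sup>2) / (2 * pi))})" if T: "T \<ge> T0" "T > 0" for T
    proof -
      obtain X where X: "X \<subseteq> A" "c * T\<^sup>2 \<le> real (card X)" "inj_on Arg X"
        "\<And>x. x \<in> X \<Longrightarrow> x \<noteq> 0 \<and> norm x < T \<and> (\<exists>y\<in>A. norm y < T \<and> Im (cnj x * y) = K \<and> (1 - \<epsilon>) * T\<^sup>2 \<le> Re (cnj x * y))"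
        using c(2)[OF T(1)] unfolding A_def K_def by blast
      have "(1 - \<epsilon>) * T\<^sup>2 > 0" using \<epsilon> T by simp
      from card_small_gaps[OF fin X(3,1) K this X(4)] X(2) show ?thesis unfolding N_def by linarith
    qed
    then show ?thesis using c(1)
      by (intro exI[of _ c] conjI eventually_mono[OF eventually_conj[OF eventually_ge_at_top[of T0] eventually_gt_at_top[of 0]]]) auto
  qed
  have sq: "eventually (\<lambda>T::real. T\<^sup>2 \<ge> B) at_top" for B :: real
  proof -
    have "filterlim (\<lambda>T::real. T\<^sup>2) at_top at_top" by (rule filterlim_pow_at_top) (auto intro: filterlim_ident)
    then show ?thesis by (simp add: filterlim_at_top)
  qed
  have card_le: "real (card {i \<in> {1..num_visible A T}. Q i}) \<le> N T" for T Q
  proof -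
    have "card {i \<in> {1..num_visible A T}. Q i} \<le> card {1..num_visible A T}" by (intro card_mono) auto
    then show ?thesis by (simp add: N_def)
  qed
  \<comment> \<open>For large T, \<open>pairs\<close> provides at least c T^2 / 2 gaps, and N T is
    the number of all gaps.\<close>
  have \<theta>pos: "\<theta> > 0"
  proof -
    obtain c where c: "c > 0" "eventually (\<lambda>T. c * T\<^sup>2 \<le> 1 + real (card {i \<in> {1..num_visible A T}.
      gap A T i \<le> N T * (K / ((1 - 1/5) * T\<^sup>2) / (2 * pi))})) at_top" using pairs[of "1/5"] by auto
    have "eventually (\<lambda>T. c / (2 * pi) \<le> N T / (pi * T\<^sup>2)) at_top"
      using c(2) sq[of "2 / c"] eventually_gt_at_top[of 0]
    proof eventually_elim
      case (elim T)
      have "c * T\<^sup>2 \<le> 1 + N T" using elim(1) card_le by (meson add_left_mono order_trans)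
      moreover have "c * T\<^sup>2 \<ge> 2" using elim(2) c(1) by (simp add: pos_divide_le_eq mult.commute)
      ultimately have "c / 2 * T\<^sup>2 \<le> N T" by simp
      then show ?case using elim(3) by (simp add: field_simps)
    qed
    then have "c / (2 * pi) \<le> \<theta>" by (intro tendsto_lowerbound[OF lim]) auto
    moreover have "c / (2 * pi) > 0" using c(1) by simp
    ultimately show ?thesis by linarith
  qed
  \<comment> \<open>The critical gap N (K / T^2) / (2 pi) equals K / 2 times N / (pi T^2), which
    tends to K \<theta> / 2.\<close>
  have "min_gap A = K * \<theta> / 2"
  proof (rule min_gap_eq[OF \<mu>])
    show "K * \<theta> / 2 > 0" using K \<theta>pos by simp
  next
    fix s assume s: "s < K * \<theta> / 2"
    have "((\<lambda>T. K / 2 * (N T / (pi * T\<^sup>2))) \<longlongrightarrow> K / 2 * \<theta>) at_top" by (intro tendsto_intros lim)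
    moreover have "s < K / 2 * \<theta>" using s by simp
    ultimately have "eventually (\<lambda>T. s < K / 2 * (N T / (pi * T\<^sup>2))) at_top" by (rule order_tendstoD)
    then show "eventually (\<lambda>T. cdf (gap_measure A T) s = 0) at_top"
      using sq[of "K / pi"] eventually_gt_at_top[of 0]
    proof eventually_elim
      case (elim T)
      have "K / T\<^sup>2 \<le> pi" using elim(2,3) by (simp add: pos_divide_le_eq mult.commute)
      then have mn: "min pi (K / T\<^sup>2) = K / T\<^sup>2" by simp
      have "s < gap A T i" if "i \<in> {1..num_visible A T}" for i
      proof -
        have "s < N T * (min pi (K / T\<^sup>2) / (2 * pi))" unfolding mn using elim(1) by (simp add: mult_ac)
        also have "\<dots> \<le> gap A T i" unfolding N_def
        proof (rule gap_ge[OF fin elim(3) _ _ that])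
          show "K \<le> \<bar>Im (cnj x * y)\<bar>" if "x \<in> A" "y \<in> A" "Im (cnj x * y) \<noteq> 0" for x y
            unfolding K_def using that Im_A_set_ge[OF assms(1) bW assms(4) m(2)] by (simp add: A_def)
        qed (use K in simp)
        finally show ?thesis .
      qed
      then have "{i \<in> {1..num_visible A T}. gap A T i \<le> s} = {}" by force
      then show ?case unfolding cdf_gap_measure by simp
    qed
  next
    fix s assume s: "s > K * \<theta> / 2"
    have s0: "s > 0" using s K \<theta>pos by (meson divide_pos_pos less_trans mult_pos_pos zero_less_numeral)
    \<comment> \<open>The gaps of \<open>pairs\<close> are bounded by a quantity tending to K
      \<theta> / (2 (1 - \<epsilon>)), which is below s exactly if q < 1 - \<epsilon>.\<close>
    define q where "q = K * \<theta> / 2 / s"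
    have q: "q < 1" using s s0 by (simp add: q_def)
    define \<epsilon> where "\<epsilon> = min (1/5) ((1 - q) / 2)"
    have "\<epsilon> \<le> (1 - q) / 2" unfolding \<epsilon>_def by (rule min.cobounded2)
    then have "q < 1 - \<epsilon>" using q by (simp add: field_simps)
    moreover have "0 < \<epsilon>" "\<epsilon> \<le> 1/5" using q by (simp_all add: \<epsilon>_def)
    ultimately have \<epsilon>: "0 < \<epsilon>" "\<epsilon> \<le> 1/5" "q < 1 - \<epsilon>" by blast+
    obtain c where c: "c > 0" "eventually (\<lambda>T. c * T\<^sup>2 \<le> 1 + real (card {i \<in> {1..num_visible A T}.
      gap A T i \<le> N T * (K / ((1 - \<epsilon>) * T\<^sup>2) / (2 * pi))})) at_top" using pairs[OF \<epsilon>(1,2)] by blast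
    have "((\<lambda>T. K / (2 * (1 - \<epsilon>)) * (N T / (pi * T\<^sup>2))) \<longlongrightarrow> K / (2 * (1 - \<epsilon>)) * \<theta>) at_top" by (intro tendsto_intros lim)
    moreover have "K / (2 * (1 - \<epsilon>)) * \<theta> < s" using \<epsilon> s0 by (simp add: q_def field_simps)
    ultimately have ev1: "eventually (\<lambda>T. K / (2 * (1 - \<epsilon>)) * (N T / (pi * T\<^sup>2)) < s) at_top" by (rule order_tendstoD)
    have ev2: "eventually (\<lambda>T. N T / (pi * T\<^sup>2) < \<theta> + 1) at_top" using lim by (rule order_tendstoD) simp
    \<comment> \<open>Once c T^2 \<ge> 2 absorbs the summand 1, at least c T^2 / 2 gaps are at most
      s, out of fewer than (\<theta> + 1) pi T^2.\<close>
    define d where "d = c / (2 * (pi * (\<theta> + 1)))"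
    have "eventually (\<lambda>T. d \<le> cdf (gap_measure A T) s) at_top"
      using c(2) ev1 ev2 sq[of "2 / c"] eventually_gt_at_top[of 0]
    proof eventually_elim
      case (elim T)
      let ?S = "{i \<in> {1..num_visible A T}. gap A T i \<le> N T * (K / ((1 - \<epsilon>) * T\<^sup>2) / (2 * pi))}"
      let ?R = "{i \<in> {1..num_visible A T}. gap A T i \<le> s}"
      have "N T * (K / ((1 - \<epsilon>) * T\<^sup>2) / (2 * pi)) = K / (2 * (1 - \<epsilon>)) * (N T / (pi * T\<^sup>2))"
        by (simp only: times_divide_eq_left times_divide_eq_right divide_divide_eq_left mult_ac)
      then have "N T * (K / ((1 - \<epsilon>) * T\<^sup>2) / (2 * pi)) < s" using elim(2) by simp
      then have "card ?S \<le> card ?R" by (intro card_mono) auto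
      moreover have "c * T\<^sup>2 \<ge> 2" using elim(4) c(1) by (simp add: pos_divide_le_eq mult.commute)
      ultimately have R: "c / 2 * T\<^sup>2 \<le> real (card ?R)" using elim(1) by simp
      have "c / 2 * T\<^sup>2 > 0" using c(1) elim(5) by simp
      then have Npos: "N T > 0" using R card_le[of T "\<lambda>i. gap A T i \<le> s"] by linarith
      have "N T \<le> (\<theta> + 1) * (pi * T\<^sup>2)" using elim(3,5) by (simp add: pos_divide_less_eq)
      then have "d * N T \<le> d * ((\<theta> + 1) * (pi * T\<^sup>2))" using c(1) \<theta>pos by (intro mult_left_mono) (auto simp: d_def)
      also have "\<dots> = c / 2 * T\<^sup>2" using \<theta>pos by (simp add: d_def)
      also have "\<dots> \<le> real (card ?R)" by (rule R)
      finally show ?case unfolding cdf_gap_measure N_def[symmetric] using Npos by (simp add: pos_le_divide_eq)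
    qed
    moreover have "d > 0" using c(1) \<theta>pos by (simp add: d_def)
    ultimately show "\<exists>d>0. eventually (\<lambda>T. d \<le> cdf (gap_measure A T) s) at_top" by blast
  qed
  then show ?thesis using density_of_eq[OF \<theta>] by (simp add: A_def K_def mult_ac)
qed

end
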